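(* Let $k\ge 0$ and $n\ge 1$ be integers, and let $\mathsf{V}$ be the complex vector space with basis $v_0,v_1,\dots,v_n$. For each rook-Brauer $k$-diagram $d$, let $d$ act on $\mathsf{V}^{\otimes k}$ by the linear map $$d\,(v_{i_1}\otimes\cdots\otimes v_{i_k})=\sum_{j_1,\dots,j_k\in\{0,\dots,n\}}(d)_{i_1,\dots,i_k}^{j_1,\dots,j_k}\;v_{j_1}\otimes\cdots\otimes v_{j_k},$$ where the coefficients $(d)_{i_1,\dots,i_k}^{j_1,\dots,j_k}$ are those defined in the context. Then the linear map $\pi_k:\mathsf{RB}_k(n+1)\to\operatorname{End}(\mathsf{V}^{\otimes k})$ determined by this action of the basis diagrams is an algebra representation (a homomorphism of unital algebras over $\mathbb{C}$).
   Context: A rook-Brauer $k$-diagram is a graph on two rows of $k$ vertices each (a top row and a bottom row, each numbered $1,\dots,k$ from left to right) in which each vertex is joined by an edge to at most one other vertex. The set of these diagrams is $\mathcal{RB}_k$. For $x\in\mathbb{C}$, the rook-Brauer algebra $\mathsf{RB}_k(x)$ is the $\mathbb{C}$-vector space with basis $\mathcal{RB}_k$ (with $\mathsf{RB}_0(x)=\mathbb{C}1$) and bilinear multiplication determined as follows. For diagrams $d_1,d_2$, place $d_1$ above $d_2$ and identify the bottom vertices of $d_1$ with the corresponding top vertices of $d_2$. Then $d_1d_2=x^{\kappa(d_1,d_2)}d_3$, where $\kappa(d_1,d_2)$ is the number of closed loops formed entirely in the middle row, and $d_3$ is the rook-Brauer diagram on the top row of $d_1$ and the bottom row of $d_2$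 in which two vertices are joined by an edge if and only if they lie in the same connected component of the stacked graph. (Components contained in the middle row that are not closed loops are discarded with factor $1$.) The identity is the diagram joining the $i$th top vertex to the $i$th bottom vertex for every $i$. Coefficients: label the bottom vertices of $d$ from left to right by $i_1,\dots,i_k$ and the top vertices by $j_1,\dots,j_k$. Then $(d)_{i_1,\dots,i_k}^{j_1,\dots,j_k}$ is the product over all connected components of $d$ (edges and isolated vertices) of the following weights: an isolated vertex labeled $a$ has weight $\delta_{a,0}$, and an edge joining vertices labeled $a$ and $b$ has weight $\delta_{a,b}$ (Kronecker deltas). *)

theory Defs
  imports Complex_Main "HOL-Library.FuncSet" "HOL-Algebra.Module"
begin

section \<open>Rook-Brauer diagrams\<close>

datatype vertex = Top nat | Bot nat

definition vertices :: "nat \<Rightarrow> vertex set" where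
  "vertices k = Top ` {1..k} \<union> Bot ` {1..k}"

text \<open>A diagram is identified with its edge set; an edge is a two-element set of vertices.\<close>

type_synonym diagram = "vertex set set"

definition RB :: "nat \<Rightarrow> diagram set" where
  "RB k = {d. (\<forall>e\<in>d. e \<subseteq> vertices k \<and> card e = 2) \<and>
              (\<forall>a b c. {a, b} \<in> d \<longrightarrow> {a, c} \<in> d \<longrightarrow> b = c)}"

definition id_diagram :: "nat \<Rightarrow> diagram" where
  "id_diagram k = (\<lambda>r. {Top r, Bot r}) ` {1..k}"


section \<open>Stacking\<close>

text \<open>
  In the stacked graph with \<open>d1\<close> above \<open>d2\<close>, the bottom row of \<open>d1\<close> and the top row of \<open>d2\<close>
  are identified to form the middle row.  A pair of middle vertices may be joined both in \<open>d1\<close>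
  and in \<open>d2\<close>, which gives a closed loop of length two, so the stacked graph is a multigraph:
  its edges are the elements of the disjoint union \<open>d1 <+> d2\<close>.
\<close>

datatype stacked_vertex = Upper nat | Middle nat | Lower nat

definition stacked_vertices :: "nat \<Rightarrow> stacked_vertex set" where
  "stacked_vertices k = Upper ` {1..k} \<union> Middle ` {1..k} \<union> Lower ` {1..k}"

primrec in_first :: "vertex \<Rightarrow> stacked_vertex" where
  "in_first (Top r) = Upper r"
| "in_first (Bot r) = Middle r"

primrec in_second :: "vertex \<Rightarrow> stacked_vertex" where
  "in_second (Top r) = Middle r"
| "in_second (Bot r) = Lower r"

primrec in_outer :: "vertex \<Rightarrow> stacked_vertex" where
  "in_outer (Top r) = Upper r"
| "in_outer (Bot r) = Lower r"

primrec ends :: "vertex set + vertex set \<Rightarrow> stacked_vertex set" where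
  "ends (Inl e) = in_first ` e"
| "ends (Inr e) = in_second ` e"

definition connected_rel :: "diagram \<Rightarrow> diagram \<Rightarrow> (stacked_vertex \<times> stacked_vertex) set" where
  "connected_rel d1 d2 = {(u, w). \<exists>e \<in> d1 <+> d2. ends e = {u, w}}\<^sup>*"

definition components :: "nat \<Rightarrow> diagram \<Rightarrow> diagram \<Rightarrow> stacked_vertex set set" where
  "components k d1 d2 = stacked_vertices k // connected_rel d1 d2"

text \<open>
  \<open>C\<close> is the vertex set of a closed loop: its vertices and distinct edges of the stacked graph
  can be listed cyclically so that the \<open>t\<close>-th edge joins the \<open>t\<close>-th vertex to the next one.
\<close>

definition closed_loop :: "diagram \<Rightarrow> diagram \<Rightarrow> stacked_vertex set \<Rightarrow> bool" where
  "closed_loop d1 d2 C \<longleftrightarrow>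
     (\<exists>us es. us \<noteq> [] \<and> distinct us \<and> set us = C \<and>
              distinct es \<and> set es \<subseteq> d1 <+> d2 \<and> length es = length us \<and>
              (\<forall>t < length us. ends (es ! t) = {us ! t, us ! (Suc t mod length us)}))"

definition loops :: "nat \<Rightarrow> diagram \<Rightarrow> diagram \<Rightarrow> nat" where
  "loops k d1 d2 =
     card {C \<in> components k d1 d2. C \<subseteq> Middle ` {1..k} \<and> closed_loop d1 d2 C}"

definition stack :: "nat \<Rightarrow> diagram \<Rightarrow> diagram \<Rightarrow> diagram" where
  "stack k d1 d2 =
     {{a, b} | a b. a \<in> vertices k \<and> b \<in> vertices k \<and> a \<noteq> b \<and>
                    (in_outer a, in_outer b) \<in> connected_rel d1 d2}"


section \<open>Vector spaces with a given basis\<close>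

text \<open>
  For a finite set \<open>S\<close>, \<open>free_space S\<close> is the complex vector space with basis \<open>S\<close>, a vector being
  represented by its coordinate function; \<open>basis_vec s\<close> is the basis vector belonging to \<open>s\<close>.
\<close>

definition free_space :: "'a set \<Rightarrow> ('a \<Rightarrow> complex) set" where
  "free_space S = {f. \<forall>s. s \<notin> S \<longrightarrow> f s = 0}"

definition basis_vec :: "'a \<Rightarrow> 'a \<Rightarrow> complex" where
  "basis_vec s = (\<lambda>t. if t = s then 1 else 0)"


section \<open>The rook-Brauer algebra\<close>

definition RB_algebra :: "nat \<Rightarrow> complex \<Rightarrow> (complex, diagram \<Rightarrow> complex) module" where
  "RB_algebra k x =
     \<lparr>carrier = free_space (RB k),
      mult = (\<lambda>a b d. \<Sum>d1\<in>RB k. \<Sum>d2\<in>RB k.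
                a d1 * b d2 * (x ^ loops k d1 d2 * basis_vec (stack k d1 d2) d)),
      one = basis_vec (id_diagram k),
      zero = (\<lambda>d. 0),
      add = (\<lambda>a b d. a d + b d),
      smult = (\<lambda>c a d. c * a d)\<rparr>"


section \<open>The tensor power and its endomorphism algebra\<close>

text \<open>
  \<open>V n\<close> has basis \<open>v 0, \<dots>, v n\<close>.  Its \<open>k\<close>-th tensor power is modelled on coordinates: it has
  the index tuples in \<open>{0..n}\<close> of length \<open>k\<close> as basis, and a coordinate of a pure tensor is the
  product of the coordinates of its factors.
\<close>

definition V :: "nat \<Rightarrow> (nat \<Rightarrow> complex) set" where
  "V n = free_space {0..n}"

abbreviation v :: "nat \<Rightarrow> nat \<Rightarrow> complex" where
  "v \<equiv> basis_vec"

definition tuples :: "nat \<Rightarrow> nat \<Rightarrow> (nat \<Rightarrow> nat) set" where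
  "tuples n k = {1..k} \<rightarrow>\<^sub>E {0..n}"

definition tensor_power :: "nat \<Rightarrow> nat \<Rightarrow> ((nat \<Rightarrow> nat) \<Rightarrow> complex) set" where
  "tensor_power n k = free_space (tuples n k)"

definition pure_tensor :: "nat \<Rightarrow> (nat \<Rightarrow> nat \<Rightarrow> complex) \<Rightarrow> (nat \<Rightarrow> nat) \<Rightarrow> complex" where
  "pure_tensor k w = (\<lambda>i. if i \<in> extensional {1..k} then \<Prod>r\<in>{1..k}. w r (i r) else 0)"

lemma pure_tensor_mem:
  assumes "\<And>r. r \<in> {1..k} \<Longrightarrow> w r \<in> V n"
  shows "pure_tensor k w \<in> tensor_power n k"
  unfolding tensor_power_def free_space_def
proof (intro CollectI allI impI)
  fix i assume i: "i \<notin> tuples n k"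
  show "pure_tensor k w i = 0"
  proof (cases "i \<in> extensional {1..k}")
    case True
    then obtain r where r: "r \<in> {1..k}" "i r \<notin> {0..n}"
      using i by (auto simp: tuples_def PiE_def Pi_def)
    then have "w r (i r) = 0"
      using assms by (auto simp: V_def free_space_def)
    then show ?thesis
      using r by (auto simp: pure_tensor_def)
  qed (simp add: pure_tensor_def)
qed

lemma pure_tensor_basis:
  assumes "i \<in> tuples n k"
  shows "pure_tensor k (\<lambda>r. v (i r)) = basis_vec i"
proof
  fix j
  show "pure_tensor k (\<lambda>r. v (i r)) j = basis_vec i j"
  proof (cases "j = i")
    case True
    then show ?thesis
      using assms by (auto simp: pure_tensor_def basis_vec_def tuples_def PiE_def)
  next
    case False
    have "(\<Prod>r\<in>{1..k}. v (i r) (j r)) = 0" if j: "j \<in> extensional {1..k}"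
    proof -
      have "i \<in> extensional {1..k}"
        using assms by (simp add: tuples_def PiE_def)
      then obtain r where "r \<in> {1..k}" "j r \<noteq> i r"
        using extensionalityI [OF j] False by blast
      then show ?thesis
        by (intro prod_zero) (auto simp: basis_vec_def)
    qed
    moreover have "basis_vec i j = 0"
      using False by (simp add: basis_vec_def)
    ultimately show ?thesis
      by (simp add: pure_tensor_def)
  qed
qed

definition End_algebra ::
  "nat \<Rightarrow> nat \<Rightarrow>
    (complex, ((nat \<Rightarrow> nat) \<Rightarrow> complex) \<Rightarrow> ((nat \<Rightarrow> nat) \<Rightarrow> complex)) module" where
  "End_algebra n k =
    (let T = tensor_power n k in
     \<lparr>carrier = {f \<in> T \<rightarrow>\<^sub>E T.
        (\<forall>s\<in>T. \<forall>t\<in>T. f (\<lambda>i. s i + t i) = (\<lambda>i. f s i + f t i)) \<and>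
        (\<forall>c. \<forall>t\<in>T. f (\<lambda>i. c * t i) = (\<lambda>i. c * f t i))},
      mult = compose T,
      one = restrict (\<lambda>t. t) T,
      zero = restrict (\<lambda>t i. 0) T,
      add = (\<lambda>f g. restrict (\<lambda>t i. f t i + g t i) T),
      smult = (\<lambda>c f. restrict (\<lambda>t i. c * f t i) T)\<rparr>)"


section \<open>The action of diagrams\<close>

fun label :: "(nat \<Rightarrow> nat) \<Rightarrow> (nat \<Rightarrow> nat) \<Rightarrow> vertex \<Rightarrow> nat" where
  "label i j (Bot r) = i r"
| "label i j (Top r) = j r"

definition isolated :: "nat \<Rightarrow> diagram \<Rightarrow> vertex set" where
  "isolated k d = {a \<in> vertices k. \<forall>e\<in>d. a \<notin> e}"

definition edge_weight :: "(vertex \<Rightarrow> nat) \<Rightarrow> vertex set \<Rightarrow> complex" where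
  "edge_weight l e = (if \<forall>a\<in>e. \<forall>b\<in>e. l a = l b then 1 else 0)"

definition vertex_weight :: "(vertex \<Rightarrow> nat) \<Rightarrow> vertex \<Rightarrow> complex" where
  "vertex_weight l a = (if l a = 0 then 1 else 0)"

text \<open>The bottom labels are \<open>i\<close> and the top labels are \<open>j\<close>.\<close>

definition coeff :: "nat \<Rightarrow> diagram \<Rightarrow> (nat \<Rightarrow> nat) \<Rightarrow> (nat \<Rightarrow> nat) \<Rightarrow> complex" where
  "coeff k d i j =
     (\<Prod>a\<in>isolated k d. vertex_weight (label i j) a) * (\<Prod>e\<in>d. edge_weight (label i j) e)"

text \<open>
  The action of \<open>d\<close> is the linear extension of its values on the basis tensors, and \<open>\<pi>\<close> is in turn
  the linear extension of \<open>d \<mapsto> action n k d\<close>; see \<open>action_basis\<close> and \<open>\<pi>_basis\<close> below.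
\<close>

definition action ::
  "nat \<Rightarrow> nat \<Rightarrow> diagram \<Rightarrow> ((nat \<Rightarrow> nat) \<Rightarrow> complex) \<Rightarrow> ((nat \<Rightarrow> nat) \<Rightarrow> complex)" where
  "action n k d =
     (\<lambda>t\<in>tensor_power n k. \<lambda>m. \<Sum>i\<in>tuples n k. t i *
        (\<Sum>j\<in>tuples n k. coeff k d i j * pure_tensor k (\<lambda>r. v (j r)) m))"

definition \<pi> ::
  "nat \<Rightarrow> nat \<Rightarrow> (diagram \<Rightarrow> complex) \<Rightarrow>
     ((nat \<Rightarrow> nat) \<Rightarrow> complex) \<Rightarrow> ((nat \<Rightarrow> nat) \<Rightarrow> complex)" where
  "\<pi> n k a = (\<lambda>t\<in>tensor_power n k. \<lambda>m. \<Sum>d\<in>RB k. a d * action n k d t m)"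

lemma finite_tuples: "finite (tuples n k)"
  by (simp add: tuples_def finite_PiE)

lemma finite_RB: "finite (RB k)"
proof (rule finite_subset)
  show "RB k \<subseteq> Pow (Pow (vertices k))"
    by (auto simp: RB_def)
  show "finite (Pow (Pow (vertices k)))"
    by (simp add: vertices_def)
qed

lemma sum_basis_vec:
  assumes "finite S" "s \<in> S"
  shows "(\<Sum>s'\<in>S. basis_vec s s' * f s') = f s"
proof -
  have "(\<Sum>s'\<in>S. basis_vec s s' * f s') = (\<Sum>s'\<in>S. if s' = s then f s' else 0)"
    by (rule sum.cong) (simp_all add: basis_vec_def)
  also have "\<dots> = f s"
    using assms by simp
  finally show ?thesis .
qed

lemma action_basis:
  assumes "i \<in> tuples n k"
  shows "action n k d (pure_tensor k (\<lambda>r. v (i r))) =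
           (\<lambda>m. \<Sum>j\<in>tuples n k. coeff k d i j * pure_tensor k (\<lambda>r. v (j r)) m)"
proof -
  have "basis_vec i \<in> tensor_power n k"
    using assms by (auto simp: tensor_power_def free_space_def basis_vec_def)
  then show ?thesis
    unfolding pure_tensor_basis [OF assms] action_def
    by (simp only: restrict_apply' sum_basis_vec [OF finite_tuples assms])
qed

lemma \<pi>_basis:
  assumes "d \<in> RB k"
  shows "\<pi> n k (basis_vec d) = action n k d"
proof -
  have "\<pi> n k (basis_vec d) = (\<lambda>t\<in>tensor_power n k. action n k d t)"
    unfolding \<pi>_def by (simp only: sum_basis_vec [OF finite_RB assms])
  also have "\<dots> = action n k d"
    by (simp only: action_def restrict_restrict Int_absorb)
  finally show ?thesis .
qed


section \<open>Homomorphisms of unital complex algebras\<close>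

definition algebra_hom ::
  "(complex, 'a) module \<Rightarrow> (complex, 'b) module \<Rightarrow> ('a \<Rightarrow> 'b) set" where
  "algebra_hom A B =
     {h \<in> ring_hom A B. \<forall>c. \<forall>a\<in>carrier A. h (c \<odot>\<^bsub>A\<^esub> a) = c \<odot>\<^bsub>B\<^esub> h a}"

end

(* Stack d1 above d2.  Every vertex of the stacked multigraph has degree at most two, so a component
   is a path or a cycle.  Fix bottom labels i and top labels j.  A labelling of the middle row
   contributes 1 to the (i, j) entry of the product of the matrices of d1 and d2 exactly if it is
   constant on components and 0 at isolated vertices of d1 and d2, and otherwise 0.  A path has two
   ends, each of them an outer vertex or an isolated vertex of d1 or d2 (a single vertex may count
   twice), so labels on a path are determined by i and j; each closed loop leaves a free choice
   among n + 1 labels.  This matches the loop factor x = n + 1. *)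

theory Submission
  imports Defs
begin

section \<open>Components of multigraphs of maximum degree two\<close>

text \<open>Edges are abstract objects with an end map, because two middle vertices joined in both
  diagrams form a loop that a simple graph does not show. Only degrees enter the classification of
  components: a vertex of degree other than two is an end. The delicate point is the comparison with
  the stacked diagram, which remembers outer vertices only. A path with two outer ends asks there
  for equal labels and nothing more, so it must be shown to contain no isolated vertex of
  \<open>d1\<close> or \<open>d2\<close>. A path with a single outer vertex asks for label 0, so an
  isolated vertex of \<open>d1\<close> or \<open>d2\<close> must be produced in it. A path without
  outer vertices forces 0 on all its labels, which accounts for the factor 1 of discarded
  components.\<close>

locale degree_two_graph =
  fixes E :: "'e set" and ep :: "'e \<Rightarrow> 'v set"
  assumes finite_E: "finite E"
    and card_ep: "e \<in> E \<Longrightarrow> card (ep e) = 2"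
    and degree_le: "card {e \<in> E. u \<in> ep e} \<le> 2"
begin

definition inc :: "'v \<Rightarrow> 'e set" where
  "inc u = {e \<in> E. u \<in> ep e}"

definition reach :: "('v \<times> 'v) set" where
  "reach = {(u, w). \<exists>e\<in>E. ep e = {u, w}}\<^sup>*"

text \<open>The edges are listed beside the vertices because parallel edges are not determined by
  their ends.\<close>

definition path :: "'v list \<Rightarrow> 'e list \<Rightarrow> bool" where
  "path us es \<longleftrightarrow> distinct us \<and> length us = Suc (length es) \<and> set es \<subseteq> E \<and>
     (\<forall>t < length es. ep (es ! t) = {us ! t, us ! Suc t})"

lemma finite_inc: "finite (inc u)"
  using finite_E by (simp add: inc_def)

lemma card_inc_le: "card (inc u) \<le> 2"
  using degree_le by (simp add: inc_def)

lemma inc_eq_pair: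
  assumes "e \<in> inc u" "f \<in> inc u" "e \<noteq> f"
  shows "inc u = {e, f}"
proof -
  have "{e, f} = inc u"
    using assms card_inc_le [of u] by (intro card_seteq finite_inc) auto
  then show ?thesis ..
qed

lemma equiv_reach: "equiv UNIV reach"
proof -
  have "sym {(u, w). \<exists>e\<in>E. ep e = {u, w}}"
    by (auto simp: sym_def insert_commute)
  then show ?thesis
    unfolding reach_def by (intro equivI refl_rtrancl trans_rtrancl sym_rtrancl) auto
qed

lemma reach_refl: "(u, u) \<in> reach"
  by (simp add: reach_def)

lemma reach_edge:
  assumes "e \<in> E" "ep e = {u, w}"
  shows "(u, w) \<in> reach"
  using assms by (auto simp: reach_def)

text \<open>Induction along a chain of edges. It bounds a component from above by any set that no
  edge leaves, such as the vertices of a maximal path or of the whole stack.\<close>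

lemma reach_subset:
  assumes "u \<in> S" "\<And>e w. e \<in> E \<Longrightarrow> w \<in> S \<Longrightarrow> w \<in> ep e \<Longrightarrow> ep e \<subseteq> S"
  shows "reach `` {u} \<subseteq> S"
proof -
  have "w \<in> S" if "(u, w) \<in> reach" for w
    using that unfolding reach_def
  proof (induction rule: rtrancl_induct)
    case base
    show ?case by fact
  next
    case (step y z)
    then show ?case using assms(2) by auto
  qed
  then show ?thesis by auto
qed

section \<open>Simple paths and maximal paths\<close>

lemma path_distinct_vertices:
  "path us es \<Longrightarrow> s \<le> length es \<Longrightarrow> t \<le> length es \<Longrightarrow> us ! s = us ! t \<longleftrightarrow> s = t"
  by (simp add: path_def nth_eq_iff_index_eq)

lemma path_inc:
  assumes "path us es" "t < length es"
  shows "es ! t \<in> inc (us ! t)" "es ! t \<in> inc (us ! Suc t)"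
  using assms by (auto simp: path_def inc_def)

lemma path_inc_iff:
  assumes "path us es" "t < length es" "s \<le> length es"
  shows "es ! t \<in> inc (us ! s) \<longleftrightarrow> s = t \<or> s = Suc t"
proof -
  have "es ! t \<in> inc (us ! s) \<longleftrightarrow> us ! s = us ! t \<or> us ! s = us ! Suc t"
    using assms by (auto simp: path_def inc_def)
  then show ?thesis
    using path_distinct_vertices [OF assms(1)] assms(2,3) by auto
qed

text \<open>The edge at index \<open>t\<close> meets the path only in the vertices at
  \<open>t\<close> and \<open>Suc t\<close>. These are distinct from all other path vertices, so an
  edge determines its index.\<close>

lemma path_distinct_edges:
  assumes "path us es"
  shows "distinct es"
  unfolding distinct_conv_nth
proof (intro allI impI notI)
  fix s t
  assume st: "s < length es" "t < length es" "s \<noteq> t" "es ! s = es ! t"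
  then have "s = t \<or> s = Suc t" "Suc s = t \<or> Suc s = Suc t"
    using path_inc [OF assms, of s] path_inc_iff [OF assms, of t] by auto
  with st show False by simp
qed

text \<open>The path edges before and after an inner vertex already exhaust the degree
  bound.\<close>

lemma path_interior:
  assumes "path us es" "0 < t" "t < length es"
  shows "inc (us ! t) = {es ! (t - 1), es ! t}" "card (inc (us ! t)) = 2"
proof -
  have "es ! (t - 1) \<noteq> es ! t"
    using path_distinct_edges [OF assms(1)] assms by (simp add: nth_eq_iff_index_eq)
  moreover have "es ! (t - 1) \<in> inc (us ! t)" "es ! t \<in> inc (us ! t)"
    using path_inc [OF assms(1)] path_inc(2) [OF assms(1), of "t - 1"] assms by auto
  ultimately show "inc (us ! t) = {es ! (t - 1), es ! t}" "card (inc (us ! t)) = 2"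
    using inc_eq_pair by (blast, metis card_2_iff inc_eq_pair)
qed

lemma path_reach:
  assumes "path us es" "t \<le> length es"
  shows "(us ! 0, us ! t) \<in> reach"
  using assms(2)
proof (induction t)
  case 0
  show ?case by (rule reach_refl)
next
  case (Suc t)
  then have "(us ! t, us ! Suc t) \<in> reach"
    using assms(1) by (intro reach_edge [of "es ! t"]) (auto simp: path_def)
  with Suc show ?case
    using equiv_reach by (meson Suc_leD equivE transE)
qed

text \<open>\<open>F\<close> stands for the edge set of the component: the path edges alone for a
  path, and the path edges with one closing edge for a cycle.\<close>

lemma component_eq_path:
  assumes p: "path us es" and sub: "set es \<subseteq> F"
    and inc: "\<And>t. t \<le> length es \<Longrightarrow> inc (us ! t) \<subseteq> F"
    and F: "\<And>e. e \<in> F \<Longrightarrow> ep e \<subseteq> set us"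
  shows "reach `` {us ! 0} = set us"
proof
  have len: "length us = Suc (length es)"
    using p by (simp add: path_def)
  show "reach `` {us ! 0} \<subseteq> set us"
  proof (rule reach_subset)
    show "us ! 0 \<in> set us" using len by simp
    fix e w assume "e \<in> E" "w \<in> set us" "w \<in> ep e"
    then obtain t where "t \<le> length es" "e \<in> inc (us ! t)"
      using len by (auto simp: in_set_conv_nth inc_def less_Suc_eq_le)
    then show "ep e \<subseteq> set us"
      using inc F by blast
  qed
  show "set us \<subseteq> reach `` {us ! 0}"
    using path_reach [OF p] len by (auto simp: in_set_conv_nth less_Suc_eq_le)
qed

lemma path_edge_subset:
  assumes "path us es" "e \<in> set es"
  shows "ep e \<subseteq> set us"
proof -
  obtain t where "t < length es" "e = es ! t"
    using assms(2) by (auto simp: in_set_conv_nth)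
  then show ?thesis
    using assms(1) by (simp add: path_def)
qed

text \<open>An edge leaving the last vertex of a maximal path can only return to its first vertex,
  since the inner vertices have no edges left.\<close>

lemma maximal_path:
  obtains us es where "path us es" "us ! 0 = u"
    "\<And>e. e \<in> inc (us ! length es) \<Longrightarrow> e \<notin> set es \<Longrightarrow>
      0 < length es \<and> ep e = {us ! length es, us ! 0}"
proof -
  let ?P = "\<lambda>(us, es). path us es \<and> us ! 0 = u"
  have start: "?P ([u], [])"
    by (simp add: path_def)
  \<comment> \<open>The edges of a path are distinct, so path lengths are bounded by the number of
    edges, and among the paths starting at \<open>u\<close> there is a longest one.\<close>
  have bound: "length (snd p) \<le> card E" if "?P p" for p
  proof -
    obtain us es where p: "p = (us, es)" by force
    then have "distinct es" "set es \<subseteq> E"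
      using that path_distinct_edges by (auto simp: path_def)
    then show ?thesis
      using finite_E p by (metis card_mono distinct_card snd_conv)
  qed
  have "\<exists>p. ?P p \<and> (\<forall>q. ?P q \<longrightarrow> length (snd q) \<le> length (snd p))"
    by (rule ex_has_greatest_nat [where P = ?P and b = "Suc (card E)", OF start])
      (use bound in \<open>simp add: less_Suc_eq_le\<close>)
  then obtain p where p: "?P p" "\<And>q. ?P q \<Longrightarrow> length (snd q) \<le> length (snd p)"
    by auto
  obtain us es where pus: "p = (us, es)" by force
  have path: "path us es" and hd: "us ! 0 = u"
    using p(1) pus by auto
  have len: "length us = Suc (length es)"
    using path by (simp add: path_def)
  show thesis
  proof (rule that [OF path hd])
    fix e assume e: "e \<in> inc (us ! length es)" "e \<notin> set es"
    let ?w = "us ! length es"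
    have "e \<in> E" "?w \<in> ep e" "card (ep e) = 2"
      using e card_ep by (auto simp: inc_def)
    then obtain w where w: "ep e = {?w, w}" "w \<noteq> ?w"
      by (metis card_2_iff doubleton_eq_iff insertE singletonD)
    have "w \<in> set us"
    proof (rule ccontr)
      assume "w \<notin> set us"
      then have "path (us @ [w]) (es @ [e])"
        using path w \<open>e \<in> E\<close> len by (auto simp: path_def nth_append less_Suc_eq)
      moreover have "(us @ [w]) ! 0 = u"
        using hd len by (simp add: nth_append)
      ultimately show False
        using p(2) [of "(us @ [w], es @ [e])"] pus by simp
    qed
    then obtain t where t: "t \<le> length es" "w = us ! t"
      using len by (auto simp: in_set_conv_nth less_Suc_eq_le)
    with w have "t < length es"
      by (cases "t = length es") auto
    have "t = 0"
    proof (rule ccontr)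
      assume "t \<noteq> 0"
      moreover have "e \<in> inc (us ! t)"
        using w t \<open>e \<in> E\<close> by (simp add: inc_def)
      moreover have "es ! (t - 1) \<in> set es" "es ! t \<in> set es"
        using \<open>t < length es\<close> by auto
      ultimately show False
        using path_interior(1) [OF path _ \<open>t < length es\<close>] e(2) by auto
    qed
    then show "0 < length es \<and> ep e = {?w, us ! 0}"
      using w t \<open>t < length es\<close> by simp
  qed
qed

text \<open>A longest path from \<open>u\<close> cannot close up: a return edge would be a second
  edge at \<open>u\<close>. Its last vertex therefore has no edge outside the path, and the path
  exhausts the component. The case \<open>u = w\<close> is that of an isolated vertex.\<close>

lemma component_path:
  assumes u: "card (inc u) \<le> 1"
  obtains w where "w \<in> reach `` {u}"
    "\<And>z. z \<in> reach `` {u} \<Longrightarrow> z \<noteq> u \<Longrightarrow> z \<noteq> w \<Longrightarrow> card (inc z) = 2"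
    "card (inc u) = (if u = w then 0 else 1)" "card (inc w) = (if u = w then 0 else 1)"
proof -
  obtain us es where p: "path us es" and hd: "us ! 0 = u"
    and max: "\<And>e. e \<in> inc (us ! length es) \<Longrightarrow> e \<notin> set es \<Longrightarrow>
      0 < length es \<and> ep e = {us ! length es, us ! 0}"
    by (rule maximal_path [of u]) blast
  let ?w = "us ! length es"
  have len: "length us = Suc (length es)"
    using p by (simp add: path_def)
  have first: "inc u = {es ! 0}" if "0 < length es"
  proof -
    have "es ! 0 \<in> inc u"
      using path_inc(1) [OF p that] hd by simp
    then have "{es ! 0} = inc u"
      using u by (intro card_seteq finite_inc) auto
    then show ?thesis ..
  qed
  have last: "inc ?w \<subseteq> set es"
  proof
    fix e assume e: "e \<in> inc ?w"
    show "e \<in> set es"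
    proof (rule ccontr)
      assume ne: "e \<notin> set es"
      then have "0 < length es" "e \<in> inc u"
        using max [OF e] e hd by (auto simp: inc_def)
      then show False
        using first ne by auto
    qed
  qed
  have inc: "inc (us ! t) \<subseteq> set es" if t: "t \<le> length es" for t
  proof -
    consider "t = length es" | "t = 0" "0 < length es" | "0 < t" "t < length es"
      using t by linarith
    then show ?thesis
    proof cases
      case 1
      with last show ?thesis by simp
    next
      case 2
      with first hd show ?thesis by auto
    next
      case 3
      with path_interior(1) [OF p 3] show ?thesis by auto
    qed
  qed
  have C: "reach `` {u} = set us"
    using component_eq_path [OF p order_refl inc path_edge_subset [OF p]] hd by simp
  have eq: "u = ?w \<longleftrightarrow> length es = 0"
    using path_distinct_vertices [OF p, of 0 "length es"] hd by auto
  have last_eq: "inc ?w = {es ! (length es - 1)}" if "0 < length es"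
  proof -
    have "e = es ! (length es - 1)" if "e \<in> inc ?w" for e
    proof -
      obtain t where "t < length es" "e = es ! t"
        using last \<open>e \<in> inc ?w\<close> by (metis in_set_conv_nth subsetD)
      moreover from this have "length es = Suc t"
        using path_inc_iff [OF p, of t "length es"] that by auto
      ultimately show ?thesis by simp
    qed
    moreover have "es ! (length es - 1) \<in> inc ?w"
      using path_inc(2) [OF p, of "length es - 1"] that by simp
    ultimately show ?thesis by blast
  qed
  show thesis
  proof (rule that)
    show "?w \<in> reach `` {u}"
      using C len by simp
    show "card (inc z) = 2" if z: "z \<in> reach `` {u}" "z \<noteq> u" "z \<noteq> ?w" for z
    proof -
      obtain t where "t \<le> length es" "z = us ! t"
        using z(1) C len by (auto simp: in_set_conv_nth less_Suc_eq_le)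
      moreover from this z hd have "0 < t" "t < length es"
        by (metis gr0I, metis order_le_less)
      ultimately show ?thesis
        using path_interior(2) [OF p] by simp
    qed
    show "card (inc u) = (if u = ?w then 0 else 1)"
      using eq first last by auto
    show "card (inc ?w) = (if u = ?w then 0 else 1)"
      using eq last_eq last by auto
  qed
qed

text \<open>The last vertex of a longest path meets at most one path edge but has degree two. Its
  other edge must return to the first vertex, and then no vertex of the path has an edge
  left.\<close>

lemma component_cycle:
  assumes deg: "\<And>z. z \<in> reach `` {u} \<Longrightarrow> card (inc z) = 2"
  obtains us es where "us \<noteq> []" "distinct us" "set us = reach `` {u}" "distinct es"
    "set es \<subseteq> E" "length es = length us"
    "\<forall>t < length us. ep (es ! t) = {us ! t, us ! (Suc t mod length us)}"
proof -
  obtain us es where p: "path us es" and hd: "us ! 0 = u"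
    and max: "\<And>e. e \<in> inc (us ! length es) \<Longrightarrow> e \<notin> set es \<Longrightarrow>
      0 < length es \<and> ep e = {us ! length es, us ! 0}"
    by (rule maximal_path [of u]) blast
  let ?w = "us ! length es"
  have len: "length us = Suc (length es)"
    using p by (simp add: path_def)
  \<comment> \<open>For a path without edges the left side is empty, so the unspecified element on
    the right does no harm.\<close>
  have "inc ?w \<inter> set es \<subseteq> {es ! (length es - 1)}"
  proof
    fix e assume e: "e \<in> inc ?w \<inter> set es"
    then obtain t where "t < length es" "e = es ! t"
      by (auto simp: in_set_conv_nth)
    moreover from this have "length es = Suc t"
      using path_inc_iff [OF p, of t "length es"] e by auto
    ultimately show "e \<in> {es ! (length es - 1)}" by simp
  qed
  from card_mono [OF _ this] have "card (inc ?w \<inter> set es) \<le> 1"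
    by simp
  moreover have "card (inc ?w) = 2"
    using path_reach [OF p, of "length es"] hd by (intro deg) simp
  ultimately have "\<not> inc ?w \<subseteq> set es"
    by (auto simp: Int_absorb2)
  then obtain e where e: "e \<in> inc ?w" "e \<notin> set es"
    by auto
  have pos: "0 < length es" and ep_e: "ep e = {?w, us ! 0}"
    using max [OF e] by auto
  have "e \<in> E"
    using e by (simp add: inc_def)
  have first: "inc (us ! 0) = {es ! 0, e}"
  proof (rule inc_eq_pair)
    show "es ! 0 \<in> inc (us ! 0)" using path_inc(1) [OF p pos] .
    show "e \<in> inc (us ! 0)" using ep_e \<open>e \<in> E\<close> by (simp add: inc_def)
    \<comment> \<open>If the path has one edge only, \<open>e\<close> is a parallel edge with the
      same two ends, and the cycle has length two.\<close>
    show "es ! 0 \<noteq> e" using e pos by auto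
  qed
  have last: "inc ?w = {es ! (length es - 1), e}"
  proof (rule inc_eq_pair [OF _ e(1)])
    show "es ! (length es - 1) \<in> inc ?w"
      using path_inc(2) [OF p, of "length es - 1"] pos by simp
    show "es ! (length es - 1) \<noteq> e" using e pos by auto
  qed
  have inc: "inc (us ! t) \<subseteq> set (es @ [e])" if t: "t \<le> length es" for t
  proof -
    consider "t = length es" | "t = 0" | "0 < t" "t < length es"
      using t by linarith
    then show ?thesis
    proof cases
      case 1
      with last pos show ?thesis by auto
    next
      case 2
      with first pos show ?thesis by auto
    next
      case 3
      with path_interior(1) [OF p 3] show ?thesis by auto
    qed
  qed
  have closed: "ep f \<subseteq> set us" if "f \<in> set (es @ [e])" for f
  proof (cases "f = e")
    case True
    with ep_e len show ?thesis by simp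
  next
    case False
    with that path_edge_subset [OF p] show ?thesis by simp
  qed
  have "set es \<subseteq> set (es @ [e])"
    by auto
  from component_eq_path [OF p this inc closed] have C: "reach `` {u} = set us"
    using hd by simp
  show thesis
  proof (rule that)
    show "us \<noteq> []" using len by auto
    show "distinct us" using p by (simp add: path_def)
    show "set us = reach `` {u}" using C ..
    show "distinct (es @ [e])" using path_distinct_edges [OF p] e by simp
    show "set (es @ [e]) \<subseteq> E" using p \<open>e \<in> E\<close> by (simp add: path_def)
    show "length (es @ [e]) = length us" using len by simp
    show "\<forall>t < length us. ep ((es @ [e]) ! t) = {us ! t, us ! (Suc t mod length us)}"
    proof (intro allI impI)
      fix t assume "t < length us"
      then consider "t < length es" | "t = length es"
        using len by linarith
      then show "ep ((es @ [e]) ! t) = {us ! t, us ! (Suc t mod length us)}"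
      proof cases
        case 1
        then show ?thesis using p len by (simp add: path_def nth_append)
      next
        case 2
        then show ?thesis using ep_e len by simp
      qed
    qed
  qed
qed

text \<open>The edges to the cyclic predecessor and successor are distinct and fill the degree
  bound. A cycle of length one is excluded because every edge has two ends.\<close>

lemma cycle_degree:
  assumes es: "distinct es" "set es \<subseteq> E" "length es = length us"
    and ep: "\<forall>t < length us. ep (es ! t) = {us ! t, us ! (Suc t mod length us)}"
    and z: "z \<in> set us"
  shows "card (inc z) = 2"
proof -
  obtain t where t: "t < length us" "z = us ! t"
    using z by (auto simp: in_set_conv_nth)
  let ?m = "length us"
  have in_E: "es ! r \<in> E" if "r < ?m" for r
    using that es by (metis nth_mem subsetD)
  have "?m \<noteq> 1"
  proof
    assume "?m = 1"
    then have "ep (es ! 0) = {us ! 0}" "es ! 0 \<in> E"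
      using ep in_E [of 0] by simp_all
    then show False
      using card_ep [of "es ! 0"] by simp
  qed
  \<comment> \<open>\<open>s\<close> is the cyclic predecessor of \<open>t\<close>.\<close>
  define s where "s = (if t = 0 then ?m - 1 else t - 1)"
  have s: "s < ?m" "s \<noteq> t" "Suc s mod ?m = t"
    using t \<open>?m \<noteq> 1\<close> by (auto simp: s_def)
  have "es ! s \<in> inc z" "es ! t \<in> inc z"
    using ep in_E s t by (simp_all add: inc_def)
  moreover have "es ! s \<noteq> es ! t"
    using es s t by (simp add: nth_eq_iff_index_eq)
  ultimately have "inc z = {es ! s, es ! t}"
    by (intro inc_eq_pair)
  with \<open>es ! s \<noteq> es ! t\<close> show ?thesis
    by simp
qed

end

section \<open>Stacked diagrams\<close>

lemma finite_diagram: "d \<in> RB k \<Longrightarrow> finite d"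
  by (rule finite_subset [of _ "Pow (vertices k)"]) (auto simp: RB_def vertices_def)

lemma RB_edge_unique:
  assumes "d \<in> RB k" "e \<in> d" "f \<in> d" "a \<in> e" "a \<in> f"
  shows "e = f"
proof -
  have "card e = 2" "card f = 2"
    using assms by (auto simp: RB_def)
  then obtain b c where "e = {a, b}" "f = {a, c}"
    using assms by (metis card_2_iff doubleton_eq_iff insertE singletonD)
  then show ?thesis
    using assms by (auto simp: RB_def)
qed

lemma card_RB_edges:
  assumes "d \<in> RB k" "a \<in> vertices k"
  shows "card {e \<in> d. a \<in> e} = (if a \<in> isolated k d then 0 else 1)"
proof (cases "a \<in> isolated k d")
  case True
  then have "{e \<in> d. a \<in> e} = {}"
    by (auto simp: isolated_def)
  with True show ?thesis
    by (metis card.empty)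
next
  case False
  then obtain e where "e \<in> d" "a \<in> e"
    using assms(2) by (auto simp: isolated_def)
  then have "{e \<in> d. a \<in> e} = {e}"
    using RB_edge_unique [OF assms(1)] by auto
  with False show ?thesis
    by simp
qed

lemma inj_in_first: "inj in_first"
  by (rule injI) (metis in_first.simps stacked_vertex.distinct stacked_vertex.inject vertex.exhaust)

lemma inj_in_second: "inj in_second"
  by (rule injI) (metis in_second.simps stacked_vertex.distinct stacked_vertex.inject vertex.exhaust)

lemma inj_in_outer: "inj in_outer"
  by (rule injI) (metis in_outer.simps stacked_vertex.distinct stacked_vertex.inject vertex.exhaust)

lemma mem_in_first_image:
  "Upper r \<in> in_first ` A \<longleftrightarrow> Top r \<in> A"
  "Middle r \<in> in_first ` A \<longleftrightarrow> Bot r \<in> A"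
  "Lower r \<notin> in_first ` A"
proof -
  have "in_first (Top r) = Upper r" "in_first (Bot r) = Middle r"
    by simp_all
  then show "Upper r \<in> in_first ` A \<longleftrightarrow> Top r \<in> A" "Middle r \<in> in_first ` A \<longleftrightarrow> Bot r \<in> A"
    using inj_image_mem_iff [OF inj_in_first] by metis+
  have "in_first a \<noteq> Lower r" for a
    by (cases a) auto
  then show "Lower r \<notin> in_first ` A"
    by (metis imageE)
qed

lemma mem_in_second_image:
  "Upper r \<notin> in_second ` A"
  "Middle r \<in> in_second ` A \<longleftrightarrow> Top r \<in> A"
  "Lower r \<in> in_second ` A \<longleftrightarrow> Bot r \<in> A"
proof -
  have "in_second (Top r) = Middle r" "in_second (Bot r) = Lower r"
    by simp_all
  then show "Middle r \<in> in_second ` A \<longleftrightarrow> Top r \<in> A" "Lower r \<in> in_second ` A \<longleftrightarrow> Bot r \<in> A"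
    using inj_image_mem_iff [OF inj_in_second] by metis+
  have "in_second a \<noteq> Upper r" for a
    by (cases a) auto
  then show "Upper r \<notin> in_second ` A"
    by (metis imageE)
qed

lemma mem_in_outer_image:
  "Upper r \<in> in_outer ` A \<longleftrightarrow> Top r \<in> A"
  "Middle r \<notin> in_outer ` A"
  "Lower r \<in> in_outer ` A \<longleftrightarrow> Bot r \<in> A"
proof -
  have "in_outer (Top r) = Upper r" "in_outer (Bot r) = Lower r"
    by simp_all
  then show "Upper r \<in> in_outer ` A \<longleftrightarrow> Top r \<in> A" "Lower r \<in> in_outer ` A \<longleftrightarrow> Bot r \<in> A"
    using inj_image_mem_iff [OF inj_in_outer] by metis+
  have "in_outer a \<noteq> Middle r" for a
    by (cases a) auto
  then show "Middle r \<notin> in_outer ` A"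
    by (metis imageE)
qed

lemma mem_vertices: "Top r \<in> vertices k \<longleftrightarrow> r \<in> {1..k}" "Bot r \<in> vertices k \<longleftrightarrow> r \<in> {1..k}"
  by (auto simp: vertices_def)

lemma mem_stacked_vertices:
  "Upper r \<in> stacked_vertices k \<longleftrightarrow> r \<in> {1..k}"
  "Middle r \<in> stacked_vertices k \<longleftrightarrow> r \<in> {1..k}"
  "Lower r \<in> stacked_vertices k \<longleftrightarrow> r \<in> {1..k}"
  by (auto simp: stacked_vertices_def)

lemma stacked_edges_at:
  "{e \<in> d1 <+> d2. u \<in> ends e} =
     Inl ` {e \<in> d1. u \<in> in_first ` e} \<union> Inr ` {e \<in> d2. u \<in> in_second ` e}"
  by (auto simp: Plus_def)

text \<open>The disjoint union keeps the edges of the two diagrams apart even when they have the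
  same ends, so parallel edges count twice.\<close>

lemma card_stacked_edges_at:
  assumes "finite d1" "finite d2"
  shows "card {e \<in> d1 <+> d2. u \<in> ends e} =
    card {e \<in> d1. u \<in> in_first ` e} + card {e \<in> d2. u \<in> in_second ` e}"
  unfolding stacked_edges_at
  by (subst card_Un_disjoint) (use assms in \<open>auto simp: card_image\<close>)

locale stacking =
  fixes k :: nat and d1 d2 :: diagram
  assumes d1: "d1 \<in> RB k" and d2: "d2 \<in> RB k"
begin

abbreviation R :: "(stacked_vertex \<times> stacked_vertex) set" where
  "R \<equiv> connected_rel d1 d2"

text \<open>These are the vertices where a weight of \<open>d1\<close> or \<open>d2\<close> forces
  label 0. For a middle vertex it suffices that one of the two diagrams leaves it isolated.\<close>

definition free_end :: "stacked_vertex \<Rightarrow> bool" where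
  "free_end u \<longleftrightarrow> u \<in> in_first ` isolated k d1 \<union> in_second ` isolated k d2"

definition outer :: "stacked_vertex set" where
  "outer = in_outer ` vertices k"

definition degree :: "stacked_vertex \<Rightarrow> nat" where
  "degree u = card {e \<in> d1 <+> d2. u \<in> ends e}"

lemma degree_sum:
  "degree u = card {e \<in> d1. u \<in> in_first ` e} + card {e \<in> d2. u \<in> in_second ` e}"
  unfolding degree_def using card_stacked_edges_at finite_diagram d1 d2 by blast

text \<open>Each diagram contributes at most one edge at a vertex, and only middle vertices belong
  to both diagrams. This is the source of the degree bound two.\<close>

lemma degree_eq:
  assumes "u \<in> stacked_vertices k"
  shows "degree u = (if u \<in> in_first ` (vertices k - isolated k d1) then 1 else 0) +
    (if u \<in> in_second ` (vertices k - isolated k d2) then 1 else 0)"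
  using assms card_RB_edges [OF d1] card_RB_edges [OF d2]
  by (cases u)
    (simp_all add: degree_sum mem_in_first_image mem_in_second_image mem_vertices mem_stacked_vertices)

lemma in_stacked_vertices:
  assumes "e \<in> d1 <+> d2" "u \<in> ends e"
  shows "u \<in> stacked_vertices k"
proof -
  have "in_first ` f \<subseteq> stacked_vertices k" "in_second ` f \<subseteq> stacked_vertices k"
    if "f \<in> d1 \<or> f \<in> d2" for f
  proof -
    have "f \<subseteq> vertices k"
      using that d1 d2 by (auto simp: RB_def)
    moreover have "in_first ` vertices k \<subseteq> stacked_vertices k"
      "in_second ` vertices k \<subseteq> stacked_vertices k"
      by (auto simp: vertices_def stacked_vertices_def)
    ultimately show "in_first ` f \<subseteq> stacked_vertices k" "in_second ` f \<subseteq> stacked_vertices k"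
      by blast+
  qed
  then show ?thesis
    using assms by (cases e; fastforce)
qed

sublocale degree_two_graph "d1 <+> d2" ends
proof
  show "finite (d1 <+> d2)"
    using d1 d2 finite_diagram by auto
  show "card (ends e) = 2" if "e \<in> d1 <+> d2" for e
  proof -
    have "card f = 2" if "f \<in> d1 \<or> f \<in> d2" for f
      using that d1 d2 by (auto simp: RB_def)
    then show ?thesis
      using that inj_in_first inj_in_second by (auto simp: card_image inj_on_subset)
  qed
  show "card {e \<in> d1 <+> d2. u \<in> ends e} \<le> 2" for u
  proof (cases "u \<in> stacked_vertices k")
    case True
    then show ?thesis
      using degree_eq [of u] by (simp add: degree_def)
  next
    case False
    then have "{e \<in> d1 <+> d2. u \<in> ends e} = {}"
      using in_stacked_vertices by blast
    then show ?thesis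
      by (metis card.empty zero_le)
  qed
qed

section \<open>Ends of components: outer vertices and free ends\<close>

lemma card_inc: "card (inc u) = degree u"
  by (simp add: inc_def degree_def)

lemma reach_eq: "reach = R"
  by (simp add: reach_def connected_rel_def)

lemma equiv_R: "equiv UNIV R"
  using equiv_reach by (simp add: reach_eq)

lemma refl_R: "(u, u) \<in> R"
  using reach_refl by (simp add: reach_eq)

lemma component_subset: "u \<in> stacked_vertices k \<Longrightarrow> R `` {u} \<subseteq> stacked_vertices k"
  using reach_subset [of u "stacked_vertices k"] in_stacked_vertices by (auto simp: reach_eq)

lemma outer_subset: "outer \<subseteq> stacked_vertices k"
  by (auto simp: outer_def vertices_def stacked_vertices_def)

lemma degree_outer:
  assumes "u \<in> outer"
  shows "degree u = (if free_end u then 0 else 1)"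
proof -
  have "u \<in> stacked_vertices k"
    using assms outer_subset by blast
  then show ?thesis
    using assms by (cases u) (auto simp: degree_eq outer_def free_end_def mem_in_first_image
      mem_in_second_image mem_in_outer_image)
qed

text \<open>Both diagrams must supply an edge to reach degree two. Since outer vertices have degree
  at most one, the vertices of the stack with degree other than two are exactly the outer vertices
  and the free ends.\<close>

lemma degree_middle:
  assumes "u \<in> stacked_vertices k" "u \<notin> outer"
  shows "degree u = 2 \<longleftrightarrow> \<not> free_end u"
  using assms by (cases u) (auto simp: degree_eq outer_def free_end_def mem_in_first_image
      mem_in_second_image mem_in_outer_image mem_stacked_vertices mem_vertices)

text \<open>The alternatives are decided by whether some vertex of the component has degree at most
  one. Such a vertex \<open>a\<close> replaces \<open>u\<close> as base point, since it has the same
  class.\<close>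

lemma component_cases:
  assumes "u \<in> stacked_vertices k"
  obtains (path) a b where "a \<in> R `` {u}" "b \<in> R `` {u}"
      "\<And>z. z \<in> R `` {u} \<Longrightarrow> z \<noteq> a \<Longrightarrow> z \<noteq> b \<Longrightarrow> degree z = 2"
      "degree a = (if a = b then 0 else 1)" "degree b = (if a = b then 0 else 1)"
  | (cycle) "\<And>z. z \<in> R `` {u} \<Longrightarrow> degree z = 2" "closed_loop d1 d2 (R `` {u})"
proof (cases "\<exists>a \<in> R `` {u}. degree a \<le> 1")
  case True
  then obtain a where a: "a \<in> R `` {u}" "degree a \<le> 1"
    by auto
  then have C: "R `` {u} = R `` {a}"
    using equiv_R by (metis Image_singleton_iff equiv_class_eq)
  obtain b where b: "b \<in> R `` {a}"
    "\<And>z. z \<in> R `` {a} \<Longrightarrow> z \<noteq> a \<Longrightarrow> z \<noteq> b \<Longrightarrow> degree z = 2"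
    "degree a = (if a = b then 0 else 1)" "degree b = (if a = b then 0 else 1)"
    using component_path [of a] a(2) unfolding card_inc reach_eq by blast
  show thesis
    by (rule path [of a b, unfolded C, OF a(1) [unfolded C] b])
next
  case False
  have deg: "degree z = 2" if "z \<in> R `` {u}" for z
  proof -
    have "\<not> degree z \<le> 1"
      using False that by blast
    then show ?thesis
      using card_inc_le [of z] by (simp add: card_inc)
  qed
  have "closed_loop d1 d2 (R `` {u})"
    using component_cycle [of u] deg unfolding card_inc reach_eq closed_loop_def by metis
  with deg show thesis
    by (rule cycle)
qed

lemma closed_loop_degree:
  assumes "closed_loop d1 d2 C" "z \<in> C"
  shows "degree z = 2"
  using assms cycle_degree unfolding closed_loop_def card_inc by metis

lemma outer_degree_le: "u \<in> outer \<Longrightarrow> degree u \<le> 1"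
  by (simp add: degree_outer)

lemma free_end_degree:
  "u \<in> stacked_vertices k \<Longrightarrow> free_end u \<Longrightarrow> degree u \<noteq> 2"
  using degree_outer degree_middle by fastforce

text \<open>Outer vertices have degree at most one, and a component has at most two vertices of
  degree other than two. This is what makes the stack a diagram.\<close>

lemma outer_at_most_two:
  assumes "a \<in> outer" "b \<in> outer" "c \<in> outer" "(a, b) \<in> R" "(a, c) \<in> R" "a \<noteq> b" "a \<noteq> c"
  shows "b = c"
proof -
  have a: "a \<in> R `` {a}" "a \<in> stacked_vertices k"
    using refl_R assms outer_subset by auto
  have deg: "degree a \<noteq> 2" "degree b \<noteq> 2" "degree c \<noteq> 2"
    using outer_degree_le assms by fastforce+
  from a(2) show ?thesis
  proof (cases a rule: component_cases)
    case (path x y)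
    then have "a \<in> {x, y}" "b \<in> {x, y}" "c \<in> {x, y}"
      using deg a(1) assms by auto
    then show ?thesis
      using assms by auto
  next
    case cycle
    then show ?thesis using a(1) deg by blast
  qed
qed

text \<open>The distinct outer vertices \<open>a\<close> and \<open>b\<close> are the two ends of a
  path and have degree one. A free end has degree other than two, so it would be \<open>a\<close> or
  \<open>b\<close>; but an outer free end has degree zero.\<close>

lemma two_outer_not_free:
  assumes "a \<in> outer" "b \<in> outer" "(a, b) \<in> R" "a \<noteq> b" "(a, c) \<in> R"
  shows "\<not> free_end c"
proof
  assume free: "free_end c"
  have a: "a \<in> R `` {a}" "a \<in> stacked_vertices k"
    using refl_R assms outer_subset by auto
  have c: "c \<in> stacked_vertices k"
    using component_subset [OF a(2)] assms by auto
  have deg: "degree a \<noteq> 2" "degree b \<noteq> 2" "degree c \<noteq> 2"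
    using outer_degree_le assms free_end_degree [OF c free] by fastforce+
  from a(2) show False
  proof (cases a rule: component_cases)
    case (path x y)
    then have "a \<in> {x, y}" "b \<in> {x, y}" "c \<in> {x, y}"
      using deg a(1) assms by auto
    then have "c = a \<or> c = b" "degree c = 1"
      using path assms(4) by auto
    then show False
      using degree_outer free assms by auto
  next
    case cycle
    then show False using a(1) deg by blast
  qed
qed

text \<open>The witness is the end opposite to \<open>a\<close>. If this is \<open>a\<close> itself,
  its degree is zero and \<open>a\<close> is free; otherwise it is a middle vertex of degree one,
  isolated in one of the diagrams.\<close>

lemma one_outer_free:
  assumes "a \<in> outer" "\<And>b. b \<in> outer \<Longrightarrow> (a, b) \<in> R \<Longrightarrow> b = a"
  obtains c where "(a, c) \<in> R" "free_end c"
proof -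
  have a: "a \<in> R `` {a}" "a \<in> stacked_vertices k"
    using refl_R assms outer_subset by auto
  have deg: "degree a \<noteq> 2"
    using outer_degree_le assms by fastforce
  from a(2) show thesis
  proof (cases a rule: component_cases)
    case (path x y)
    then have "a = x \<or> a = y"
      using deg a(1) by auto
    then obtain z where z: "z \<in> R `` {a}" "degree a = (if a = z then 0 else 1)"
      "degree z = (if a = z then 0 else 1)"
      using path by metis
    have "free_end z"
    proof (cases "a = z")
      case True
      then show ?thesis
        using z degree_outer assms by (metis zero_neq_one)
    next
      case False
      then have "z \<notin> outer" "z \<in> stacked_vertices k" "degree z \<noteq> 2"
        using z assms component_subset [OF a(2)] by auto
      then show ?thesis
        using degree_middle by blast
    qed
    then show thesis
      using z that by blast
  next
    case cycle
    then show thesis using a(1) deg by blast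
  qed
qed

text \<open>Replaces the cyclic lists by a condition on single vertices. Without outer vertices and
  free ends all degrees are two, which excludes a path.\<close>

lemma closed_loop_iff:
  assumes "u \<in> stacked_vertices k"
  shows "closed_loop d1 d2 (R `` {u}) \<longleftrightarrow> (\<forall>z\<in>R `` {u}. z \<notin> outer \<and> \<not> free_end z)"
proof
  assume C: "closed_loop d1 d2 (R `` {u})"
  show "\<forall>z\<in>R `` {u}. z \<notin> outer \<and> \<not> free_end z"
  proof
    fix z assume z: "z \<in> R `` {u}"
    then have "degree z = 2" "z \<in> stacked_vertices k"
      using closed_loop_degree [OF C] component_subset [OF assms] by auto
    then show "z \<notin> outer \<and> \<not> free_end z"
      using outer_degree_le free_end_degree by fastforce
  qed
next
  assume *: "\<forall>z\<in>R `` {u}. z \<notin> outer \<and> \<not> free_end z"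
  then have deg: "\<forall>z\<in>R `` {u}. degree z = 2"
    using degree_middle component_subset [OF assms] by blast
  from assms show "closed_loop d1 d2 (R `` {u})"
  proof (cases u rule: component_cases)
    case (path a b)
    then have "degree a \<noteq> 2"
      by simp
    with path(1) deg show ?thesis
      by blast
  qed
qed

lemma stack_in_RB: "stack k d1 d2 \<in> RB k"
proof -
  have edge: "(in_outer a, in_outer b) \<in> R \<and> a \<in> vertices k \<and> b \<in> vertices k \<and> a \<noteq> b"
    if "{a, b} \<in> stack k d1 d2" for a b
    using that equiv_R unfolding stack_def
    by (auto simp: doubleton_eq_iff dest: equivE symD)
  show ?thesis
    unfolding RB_def
  proof (intro CollectI conjI ballI allI impI)
    show "e \<subseteq> vertices k" "card e = 2" if "e \<in> stack k d1 d2" for e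
      using that by (auto simp: stack_def)
    fix a b c assume "{a, b} \<in> stack k d1 d2" "{a, c} \<in> stack k d1 d2"
    then have "in_outer b = in_outer c"
      using edge [of a b] edge [of a c] inj_in_outer
      by (intro outer_at_most_two [of "in_outer a"]) (auto simp: outer_def inj_eq)
    then show "b = c"
      using inj_in_outer by (simp add: inj_eq)
  qed
qed

end

section \<open>Counting compatible labellings\<close>

text \<open>All weights are 0 or 1, so a coefficient is the indicator of this predicate and an entry
  of a matrix product becomes a count.\<close>

definition compatible :: "nat \<Rightarrow> diagram \<Rightarrow> (vertex \<Rightarrow> nat) \<Rightarrow> bool" where
  "compatible k d l \<longleftrightarrow>
     (\<forall>a\<in>isolated k d. l a = 0) \<and> (\<forall>e\<in>d. \<forall>a\<in>e. \<forall>b\<in>e. l a = l b)"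

lemma prod_of_bool:
  assumes "finite A"
  shows "(\<Prod>x\<in>A. if P x then 1 else 0 :: 'a :: comm_semiring_1) = (if \<forall>x\<in>A. P x then 1 else 0)"
  using assms by (induction A rule: finite_induct) auto

lemma coeff_eq:
  assumes "d \<in> RB k"
  shows "coeff k d i j = of_bool (compatible k d (label i j))"
proof -
  have "finite (isolated k d)"
    by (rule finite_subset [of _ "vertices k"]) (auto simp: isolated_def vertices_def)
  moreover have "(if P then 1 else 0) * (if Q then 1 else 0) = (of_bool (P \<and> Q) :: complex)" for P Q
    by simp
  ultimately show ?thesis
    unfolding coeff_def vertex_weight_def edge_weight_def compatible_def
    by (simp only: prod_of_bool finite_diagram [OF assms])
qed

primrec stacked_label ::
  "(nat \<Rightarrow> nat) \<Rightarrow> (nat \<Rightarrow> nat) \<Rightarrow> (nat \<Rightarrow> nat) \<Rightarrow> stacked_vertex \<Rightarrow> nat" where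
  "stacked_label i l j (Upper r) = j r"
| "stacked_label i l j (Middle r) = l r"
| "stacked_label i l j (Lower r) = i r"

lemma stacked_label_in:
  "stacked_label i l j (in_first a) = label l j a"
  "stacked_label i l j (in_second a) = label i l a"
  "stacked_label i l j (in_outer a) = label i j a"
  by (cases a; simp)+

context stacking
begin

section \<open>Loop components and labellings of the whole stack\<close>

definition loop_components :: "stacked_vertex set set" where
  "loop_components = {C \<in> components k d1 d2. C \<subseteq> Middle ` {1..k} \<and> closed_loop d1 d2 C}"

lemma loops_eq: "loops k d1 d2 = card loop_components"
  by (simp add: loops_def loop_components_def)

lemma component_eq: "(u, w) \<in> R \<Longrightarrow> R `` {u} = R `` {w}"
  using equiv_R by (rule equiv_class_eq)

lemma finite_loop_components: "finite loop_components"
proof (rule finite_subset)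
  show "loop_components \<subseteq> (\<lambda>u. R `` {u}) ` stacked_vertices k"
    by (auto simp: loop_components_def components_def quotient_def)
qed (simp add: stacked_vertices_def)

lemma loop_components_class:
  assumes "C \<in> loop_components" "u \<in> C"
  shows "R `` {u} = C"
proof -
  obtain x where "C = R `` {x}"
    using assms(1) by (auto simp: loop_components_def components_def quotient_def)
  then show ?thesis
    using assms(2) component_eq [of x u] by simp
qed

text \<open>A vertex of the stack that is not outer lies in the middle row, so the absence of outer
  vertices yields the containment; the rest is \<open>closed_loop_iff\<close>.\<close>

lemma loop_component_iff:
  assumes "u \<in> stacked_vertices k"
  shows "R `` {u} \<in> loop_components \<longleftrightarrow> (\<forall>z\<in>R `` {u}. z \<notin> outer \<and> \<not> free_end z)"
proof -
  have "z \<in> Middle ` {1..k}" if "z \<in> stacked_vertices k" "z \<notin> outer" for z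
    using that by (auto simp: stacked_vertices_def outer_def mem_in_outer_image mem_vertices)
  then have "\<forall>z\<in>R `` {u}. z \<notin> outer \<and> \<not> free_end z \<Longrightarrow> R `` {u} \<subseteq> Middle ` {1..k}"
    using component_subset [OF assms] by blast
  moreover have "R `` {u} \<in> components k d1 d2"
    unfolding components_def using assms by (rule quotientI)
  ultimately show ?thesis
    unfolding loop_components_def mem_Collect_eq closed_loop_iff [OF assms] by argo
qed

text \<open>Outside the stack there are no free ends and \<open>R\<close> relates a vertex only to
  itself, so the unbounded quantifiers demand nothing there.\<close>

definition consistent :: "(stacked_vertex \<Rightarrow> nat) \<Rightarrow> bool" where
  "consistent s \<longleftrightarrow> (\<forall>u. free_end u \<longrightarrow> s u = 0) \<and> (\<forall>u w. (u, w) \<in> R \<longrightarrow> s u = s w)"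

lemma constant_on_edges_iff:
  "(\<forall>e\<in>d1 <+> d2. \<forall>u\<in>ends e. \<forall>w\<in>ends e. s u = s w) \<longleftrightarrow> (\<forall>u w. (u, w) \<in> R \<longrightarrow> s u = s w)"
proof (intro iffI allI impI ballI)
  fix u w
  assume *: "\<forall>e\<in>d1 <+> d2. \<forall>u\<in>ends e. \<forall>w\<in>ends e. s u = s w" and "(u, w) \<in> R"
  from this(2) show "s u = s w"
    unfolding connected_rel_def
  proof (induction rule: rtrancl_induct)
    case (step y z)
    then obtain e where "e \<in> d1 <+> d2" "ends e = {y, z}" by auto
    then have "s y = s z" using * by auto
    with step show ?case by simp
  qed simp
next
  fix e u w
  assume *: "\<forall>u w. (u, w) \<in> R \<longrightarrow> s u = s w"
    and e: "e \<in> d1 <+> d2" "u \<in> ends e" "w \<in> ends e"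
  show "s u = s w"
  proof (cases "u = w")
    case False
    moreover obtain a b where "ends e = {a, b}"
      using card_ep [OF e(1)] by (meson card_2_iff)
    ultimately have "ends e = {u, w}"
      using e(2,3) by auto
    then show ?thesis
      using reach_edge [OF e(1)] * by (simp add: reach_eq)
  qed simp
qed

text \<open>Constancy on components can be tested edge by edge, and each edge or free end comes from
  \<open>d1\<close> or \<open>d2\<close>. The row \<open>l\<close> serves as bottom of
  \<open>d1\<close> and as top of \<open>d2\<close>.\<close>

lemma consistent_iff:
  "consistent (stacked_label i l j) \<longleftrightarrow>
     compatible k d1 (label l j) \<and> compatible k d2 (label i l)"
proof -
  have edges: "(\<forall>u w. (u, w) \<in> R \<longrightarrow> stacked_label i l j u = stacked_label i l j w) \<longleftrightarrow>
    (\<forall>e\<in>d1. \<forall>a\<in>e. \<forall>b\<in>e. label l j a = label l j b) \<and>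
    (\<forall>e\<in>d2. \<forall>a\<in>e. \<forall>b\<in>e. label i l a = label i l b)"
    unfolding constant_on_edges_iff [symmetric]
    by (simp add: Plus_def ball_Un stacked_label_in)
  have free: "(\<forall>u. free_end u \<longrightarrow> stacked_label i l j u = 0) \<longleftrightarrow>
    (\<forall>a\<in>isolated k d1. label l j a = 0) \<and> (\<forall>a\<in>isolated k d2. label i l a = 0)"
    by (auto simp: free_end_def stacked_label_in)
  show ?thesis
    unfolding consistent_def compatible_def edges free by (simp only: conj_ac)
qed

text \<open>An isolated vertex of the stacked diagram is an outer vertex that is alone among outer
  vertices in its component. The row \<open>l\<close> is arbitrary, because outer vertices carry
  only \<open>i\<close> and \<open>j\<close>.\<close>

lemma compatible_stack_iff:
  "compatible k (stack k d1 d2) (label i j) \<longleftrightarrow>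
     (\<forall>a\<in>outer. \<forall>b\<in>outer. (a, b) \<in> R \<longrightarrow> stacked_label i l j a = stacked_label i l j b) \<and>
     (\<forall>a\<in>outer. (\<forall>b\<in>outer. (a, b) \<in> R \<longrightarrow> b = a) \<longrightarrow> stacked_label i l j a = 0)"
    (is "_ \<longleftrightarrow> ?A \<and> ?B")
proof -
  have symR: "(u, w) \<in> R \<Longrightarrow> (w, u) \<in> R" for u w
    using equiv_R by (meson equivE symD)
  have "(\<forall>e\<in>stack k d1 d2. \<forall>a\<in>e. \<forall>b\<in>e. label i j a = label i j b) \<longleftrightarrow>
     (\<forall>a\<in>vertices k. \<forall>b\<in>vertices k. a \<noteq> b \<longrightarrow>
        (in_outer a, in_outer b) \<in> R \<longrightarrow> label i j a = label i j b)"
    (is "?E \<longleftrightarrow> ?V")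
  proof
    assume E: ?E
    have "{a, b} \<in> stack k d1 d2"
      if "a \<in> vertices k" "b \<in> vertices k" "a \<noteq> b" "(in_outer a, in_outer b) \<in> R" for a b
      using that by (auto simp: stack_def)
    with E show ?V by blast
  next
    assume V: ?V
    show ?E
    proof
      fix e assume "e \<in> stack k d1 d2"
      then obtain a b where "e = {a, b}" "a \<in> vertices k" "b \<in> vertices k" "a \<noteq> b"
        "(in_outer a, in_outer b) \<in> R"
        unfolding stack_def by blast
      with V show "\<forall>a\<in>e. \<forall>b\<in>e. label i j a = label i j b"
        by (metis insertE singletonD)
    qed
  qed
  also have "\<dots> \<longleftrightarrow> ?A"
    unfolding outer_def ball_simps stacked_label_in by metis
  finally have edges: "(\<forall>e\<in>stack k d1 d2. \<forall>a\<in>e. \<forall>b\<in>e. label i j a = label i j b) \<longleftrightarrow> ?A" .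
  have "a \<in> isolated k (stack k d1 d2) \<longleftrightarrow> (\<forall>b\<in>outer. (in_outer a, b) \<in> R \<longrightarrow> b = in_outer a)"
    if a: "a \<in> vertices k" for a
  proof
    assume iso: "a \<in> isolated k (stack k d1 d2)"
    show "\<forall>b\<in>outer. (in_outer a, b) \<in> R \<longrightarrow> b = in_outer a"
    proof (intro ballI impI)
      fix b assume "b \<in> outer" "(in_outer a, b) \<in> R"
      then obtain c where c: "c \<in> vertices k" "b = in_outer c" "(in_outer a, in_outer c) \<in> R"
        by (auto simp: outer_def)
      then have "{a, c} \<in> stack k d1 d2 \<or> a = c"
        using a by (auto simp: stack_def)
      then show "b = in_outer a"
        using iso c by (auto simp: isolated_def)
    qed
  next
    assume *: "\<forall>b\<in>outer. (in_outer a, b) \<in> R \<longrightarrow> b = in_outer a"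
    have "a \<notin> e" if e: "e \<in> stack k d1 d2" for e
    proof
      assume "a \<in> e"
      then obtain c where "c \<in> vertices k" "c \<noteq> a" "(in_outer a, in_outer c) \<in> R"
        using e symR by (auto simp: stack_def)
      then show False
        using * inj_in_outer by (auto simp: outer_def inj_eq)
    qed
    then show "a \<in> isolated k (stack k d1 d2)"
      using a by (auto simp: isolated_def)
  qed
  moreover have "isolated k (stack k d1 d2) \<subseteq> vertices k"
    by (auto simp: isolated_def)
  ultimately have "(\<forall>a\<in>isolated k (stack k d1 d2). label i j a = 0) \<longleftrightarrow>
      (\<forall>a\<in>vertices k. (\<forall>b\<in>outer. (in_outer a, b) \<in> R \<longrightarrow> b = in_outer a) \<longrightarrow> label i j a = 0)"
    by blast
  also have "\<dots> \<longleftrightarrow> ?B"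
    by (simp add: outer_def stacked_label_in)
  finally have "(\<forall>a\<in>isolated k (stack k d1 d2). label i j a = 0) \<longleftrightarrow> ?B" .
  with edges show ?thesis
    unfolding compatible_def by blast
qed

text \<open>An outer vertex with no outer partner is connected to a free end, whose label 0 it
  inherits.\<close>

lemma consistent_imp_compatible_stack:
  assumes "consistent (stacked_label i l j)"
  shows "compatible k (stack k d1 d2) (label i j)"
  unfolding compatible_stack_iff [of i j l]
proof (intro conjI ballI impI)
  show "stacked_label i l j a = stacked_label i l j b" if "(a, b) \<in> R" for a b
    using that assms by (simp add: consistent_def)
  show "stacked_label i l j a = 0"
    if "a \<in> outer" "\<forall>b\<in>outer. (a, b) \<in> R \<longrightarrow> b = a" for a
    using that one_outer_free [of a] assms unfolding consistent_def by metis
qed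

text \<open>Rebuilds a consistent labelling from its outer labels, given by \<open>s\<close>, and
  one value of \<open>h\<close> for each loop. The final 0 is forced: a component that is neither a
  loop nor meets the outer rows contains a free end.\<close>

definition extend ::
  "(stacked_vertex \<Rightarrow> nat) \<Rightarrow> (stacked_vertex set \<Rightarrow> nat) \<Rightarrow> stacked_vertex \<Rightarrow> nat" where
  "extend s h u =
     (if R `` {u} \<in> loop_components then h (R `` {u})
      else if R `` {u} \<inter> outer \<noteq> {} then s (SOME a. a \<in> R `` {u} \<inter> outer) else 0)"

lemma extend_cong: "(u, w) \<in> R \<Longrightarrow> extend s h u = extend s h w"
  using component_eq [of u w] by (simp add: extend_def)

text \<open>An outer vertex rules out the loop case, and the choice hidden in \<open>SOME\<close> is
  immaterial because \<open>s\<close> agrees on connected outer vertices.\<close>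

lemma extend_outer:
  assumes s: "\<And>a b. a \<in> outer \<Longrightarrow> b \<in> outer \<Longrightarrow> (a, b) \<in> R \<Longrightarrow> s a = s b"
    and u: "u \<in> stacked_vertices k" and a: "a \<in> R `` {u} \<inter> outer"
  shows "extend s h u = s a"
proof -
  have "R `` {u} \<notin> loop_components"
    using loop_component_iff [OF u] a by auto
  moreover have "(SOME a. a \<in> R `` {u} \<inter> outer) \<in> R `` {u} \<inter> outer" (is "?b \<in> _")
    using a by (rule someI)
  moreover from this have "s ?b = s a"
    using a equiv_R by (intro s) (auto elim!: equivE dest: symD transD)
  ultimately show ?thesis
    using a unfolding extend_def by auto
qed

lemma consistent_eq_extend:
  assumes s: "consistent s" and u: "u \<in> stacked_vertices k"
    and h: "\<And>C. C \<in> loop_components \<Longrightarrow> h C = s (SOME z. z \<in> C)"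
  shows "s u = extend s h u"
proof -
  have const: "s u = s z" if "z \<in> R `` {u}" for z
    using that s by (auto simp: consistent_def)
  consider "R `` {u} \<in> loop_components" | a where "a \<in> R `` {u} \<inter> outer"
    | "R `` {u} \<notin> loop_components" "R `` {u} \<inter> outer = {}"
    by blast
  then show ?thesis
  proof cases
    case 1
    have "(SOME z. z \<in> R `` {u}) \<in> R `` {u}"
      by (rule someI [of _ u]) (simp add: refl_R)
    with 1 const show ?thesis
      by (simp add: extend_def h)
  next
    case 2
    then show ?thesis
      using extend_outer [OF _ u 2] s const by (auto simp: consistent_def)
  next
    case 3
    then obtain z where "z \<in> R `` {u}" "free_end z"
      using loop_component_iff [OF u] by auto
    then have "s u = 0"
      using const s by (auto simp: consistent_def)
    with 3 show ?thesis
      by (simp add: extend_def)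
  qed
qed

lemma free_end_stacked_vertex: "free_end u \<Longrightarrow> u \<in> stacked_vertices k"
  by (auto simp: free_end_def isolated_def vertices_def stacked_vertices_def)

lemma R_stacked_vertices:
  assumes "(u, w) \<in> R" "u \<noteq> w"
  shows "u \<in> stacked_vertices k"
  using assms(1) unfolding connected_rel_def
proof (cases rule: converse_rtranclE)
  case base
  with assms(2) show ?thesis by simp
next
  case (step y)
  then show ?thesis
    using in_stacked_vertices by auto
qed

text \<open>If the component meets the outer rows in \<open>a\<close>, then by
  \<open>two_outer_not_free\<close> no other outer vertex is connected to \<open>a\<close>, and
  \<open>s0\<close> gives label 0.\<close>

lemma extend_free_end:
  assumes s: "\<And>a b. a \<in> outer \<Longrightarrow> b \<in> outer \<Longrightarrow> (a, b) \<in> R \<Longrightarrow> s a = s b"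
    and s0: "\<And>a. a \<in> outer \<Longrightarrow> \<forall>b\<in>outer. (a, b) \<in> R \<longrightarrow> b = a \<Longrightarrow> s a = 0"
    and u: "free_end u"
  shows "extend s h u = 0"
proof -
  have uk: "u \<in> stacked_vertices k"
    using u by (rule free_end_stacked_vertex)
  show ?thesis
  proof (cases "R `` {u} \<inter> outer = {}")
    case True
    moreover have "R `` {u} \<notin> loop_components"
      using loop_component_iff [OF uk] u refl_R by blast
    ultimately show ?thesis
      by (simp add: extend_def)
  next
    case False
    then obtain a where a: "a \<in> R `` {u} \<inter> outer" by blast
    then have "(a, u) \<in> R"
      using equiv_R by (auto elim!: equivE dest: symD)
    then have "\<forall>b\<in>outer. (a, b) \<in> R \<longrightarrow> b = a"
      using two_outer_not_free [of a _ u] a u by blast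
    then have "s a = 0"
      using a s0 by blast
    then show ?thesis
      using extend_outer [OF s uk a] by simp
  qed
qed

text \<open>Reading off one value per loop is a bijection from the consistent middle rows to all
  functions from the loops to \<open>{0..n}\<close>; its inverse is \<open>extend\<close> on the
  middle row.\<close>

lemma card_consistent:
  assumes i: "i \<in> tuples n k" and j: "j \<in> tuples n k"
    and stack: "compatible k (stack k d1 d2) (label i j)"
  shows "card {l \<in> tuples n k. consistent (stacked_label i l j)} = (n + 1) ^ loops k d1 d2"
proof -
  \<comment> \<open>The zero middle row is a placeholder: \<open>extend\<close> consults
    \<open>s\<close> at outer vertices only.\<close>
  define s where "s = stacked_label i (\<lambda>_. 0) j"
  define restr where "restr l = (\<lambda>C\<in>loop_components. stacked_label i l j (SOME z. z \<in> C))" for l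
  define ext where "ext h = (\<lambda>r\<in>{1..k}. extend s h (Middle r))" for h
  have outer_label: "stacked_label i l j a = s a" if "a \<in> outer" for l a
    using that by (auto simp: s_def outer_def stacked_label_in)
  have s: "s a = s b" if "a \<in> outer" "b \<in> outer" "(a, b) \<in> R" for a b
    using that stack compatible_stack_iff [of i j "\<lambda>_. 0"] by (auto simp: s_def)
  have s0: "s a = 0" if "a \<in> outer" "\<forall>b\<in>outer. (a, b) \<in> R \<longrightarrow> b = a" for a
    using that stack compatible_stack_iff [of i j "\<lambda>_. 0"] by (auto simp: s_def)
  have extend_s: "extend (stacked_label i l j) h u = extend s h u" for l h u
  proof -
    have "(SOME a. a \<in> R `` {u} \<inter> outer) \<in> outer" if "R `` {u} \<inter> outer \<noteq> {}"
      using some_in_eq [of "R `` {u} \<inter> outer"] that by blast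
    then show ?thesis
      by (simp add: extend_def outer_label)
  qed
  have eq_extend: "stacked_label i l j u = extend s (restr l) u"
    if "consistent (stacked_label i l j)" "u \<in> stacked_vertices k" for l u
    using consistent_eq_extend [OF that, of "restr l"] extend_s by (simp add: restr_def)
  have ext_eq: "stacked_label i (ext h) j u = extend s h u" if u: "u \<in> stacked_vertices k" for h u
  proof (cases "u \<in> outer")
    case True
    then show ?thesis
      using outer_label extend_outer [OF s u, where a = u] refl_R by auto
  next
    case False
    with u obtain r where "u = Middle r" "r \<in> {1..k}"
      by (auto simp: stacked_vertices_def outer_def mem_in_outer_image mem_vertices)
    then show ?thesis
      by (simp add: ext_def)
  qed
  have consistent_ext: "consistent (stacked_label i (ext h) j)" for h
    unfolding consistent_def
  proof (intro conjI allI impI)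
    show "stacked_label i (ext h) j u = 0" if "free_end u" for u
      using extend_free_end [OF s s0 that] ext_eq [OF free_end_stacked_vertex [OF that]] by simp
    show "stacked_label i (ext h) j u = stacked_label i (ext h) j w" if R: "(u, w) \<in> R" for u w
    proof (cases "u = w")
      case False
      have "u \<in> stacked_vertices k" "w \<in> stacked_vertices k"
        using R_stacked_vertices [OF R False] component_subset R by auto
      then show ?thesis
        using ext_eq extend_cong [OF R] by simp
    qed simp
  qed
  have s_le: "s a \<in> {0..n}" if "a \<in> outer" for a
    using that i j by (auto simp: s_def outer_def vertices_def tuples_def PiE_def Pi_def)
  \<comment> \<open>All three branches of \<open>extend\<close> stay in range: loop values by the
    choice of \<open>h\<close>, outer labels because \<open>i\<close> and \<open>j\<close> are
    tuples, and the default 0.\<close>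
  have extend_le: "extend s h u \<in> {0..n}" if "h \<in> loop_components \<rightarrow>\<^sub>E {0..n}" for h u
  proof -
    have "(SOME a. a \<in> R `` {u} \<inter> outer) \<in> outer" if "R `` {u} \<inter> outer \<noteq> {}"
      using some_in_eq [of "R `` {u} \<inter> outer"] that by blast
    then have "s (SOME a. a \<in> R `` {u} \<inter> outer) \<in> {0..n}" if "R `` {u} \<inter> outer \<noteq> {}"
      using that s_le by blast
    moreover have "h (R `` {u}) \<in> {0..n}" if "R `` {u} \<in> loop_components"
      using that \<open>h \<in> _\<close> by blast
    ultimately show ?thesis
      unfolding extend_def by auto
  qed
  have some_mem: "(SOME z. z \<in> C) \<in> C" "(SOME z. z \<in> C) \<in> Middle ` {1..k}"
    if C: "C \<in> loop_components" for C
  proof -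
    obtain u where "C = R `` {u}"
      using C by (auto simp: loop_components_def components_def quotient_def)
    then have "u \<in> C"
      by (simp add: refl_R)
    then show "(SOME z. z \<in> C) \<in> C"
      by (rule someI)
    moreover have "C \<subseteq> Middle ` {1..k}"
      using C by (simp add: loop_components_def)
    ultimately show "(SOME z. z \<in> C) \<in> Middle ` {1..k}"
      by (rule rev_subsetD)
  qed
  have "bij_betw restr {l \<in> tuples n k. consistent (stacked_label i l j)}
      (loop_components \<rightarrow>\<^sub>E {0..n})"
  proof (rule bij_betw_byWitness [where f' = ext])
    show "\<forall>l\<in>{l \<in> tuples n k. consistent (stacked_label i l j)}. ext (restr l) = l"
    proof
      fix l assume l: "l \<in> {l \<in> tuples n k. consistent (stacked_label i l j)}"
      show "ext (restr l) = l"
      proof (rule extensionalityI [of _ "{1..k}"])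
        show "ext (restr l) \<in> extensional {1..k}"
          by (simp add: ext_def)
        show "l \<in> extensional {1..k}"
          using l by (simp add: tuples_def PiE_def)
        show "ext (restr l) r = l r" if "r \<in> {1..k}" for r
          using eq_extend [of l "Middle r"] l that by (simp add: ext_def mem_stacked_vertices)
      qed
    qed
    show "\<forall>h\<in>loop_components \<rightarrow>\<^sub>E {0..n}. restr (ext h) = h"
    proof
      fix h assume h: "h \<in> loop_components \<rightarrow>\<^sub>E {0..n}"
      show "restr (ext h) = h"
      proof (rule extensionalityI [of _ loop_components])
        show "restr (ext h) \<in> extensional loop_components"
          by (simp add: restr_def)
        show "h \<in> extensional loop_components"
          using h by (simp add: PiE_def)
        show "restr (ext h) C = h C" if C: "C \<in> loop_components" for C
        proof -
          let ?z = "SOME z. z \<in> C"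
          have "?z \<in> stacked_vertices k"
            using some_mem [OF C] by (auto simp: stacked_vertices_def)
          moreover have "R `` {?z} = C"
            using loop_components_class [OF C] some_mem [OF C] by blast
          ultimately show ?thesis
            using C by (simp add: restr_def ext_eq extend_def)
        qed
      qed
    qed
    show "restr ` {l \<in> tuples n k. consistent (stacked_label i l j)} \<subseteq> loop_components \<rightarrow>\<^sub>E {0..n}"
    proof (intro image_subsetI)
      fix l assume l: "l \<in> {l \<in> tuples n k. consistent (stacked_label i l j)}"
      have "stacked_label i l j (SOME z. z \<in> C) \<in> {0..n}" if C: "C \<in> loop_components" for C
      proof -
        obtain r where "(SOME z. z \<in> C) = Middle r" "r \<in> {1..k}"
          using some_mem(2) [OF C] by auto
        then show ?thesis
          using l by (auto simp: tuples_def)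
      qed
      then show "restr l \<in> loop_components \<rightarrow>\<^sub>E {0..n}"
        unfolding restr_def by (intro restrict_PiE_iff [THEN iffD2]) auto
    qed
    show "ext ` (loop_components \<rightarrow>\<^sub>E {0..n}) \<subseteq> {l \<in> tuples n k. consistent (stacked_label i l j)}"
    proof (intro image_subsetI CollectI conjI)
      fix h assume "h \<in> loop_components \<rightarrow>\<^sub>E {0..n}"
      then show "ext h \<in> tuples n k"
        unfolding ext_def tuples_def using extend_le by (intro restrict_PiE_iff [THEN iffD2]) blast
      show "consistent (stacked_label i (ext h) j)"
        by (rule consistent_ext)
    qed
  qed
  then show ?thesis
    by (simp add: bij_betw_same_card card_PiE finite_loop_components loops_eq)
qed

text \<open>The left side counts the consistent middle rows \<open>l\<close>. If \<open>i\<close>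
  and \<open>j\<close> do not fit the stacked diagram there are none; otherwise each loop
  contributes a factor \<open>n + 1\<close>.\<close>

lemma sum_coeff:
  assumes "i \<in> tuples n k" "j \<in> tuples n k"
  shows "(\<Sum>l\<in>tuples n k. coeff k d1 l j * coeff k d2 i l) =
    of_nat (n + 1) ^ loops k d1 d2 * coeff k (stack k d1 d2) i j"
proof -
  have "(\<Sum>l\<in>tuples n k. coeff k d1 l j * coeff k d2 i l) =
      (\<Sum>l\<in>tuples n k. of_bool (consistent (stacked_label i l j)))"
    by (simp add: coeff_eq [OF d1] coeff_eq [OF d2] consistent_iff of_bool_conj)
  also have "\<dots> = of_nat (card {l \<in> tuples n k. consistent (stacked_label i l j)})"
    using finite_tuples by (simp add: Int_def)
  also have "\<dots> = of_nat (n + 1) ^ loops k d1 d2 * coeff k (stack k d1 d2) i j"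
  proof (cases "compatible k (stack k d1 d2) (label i j)")
    case True
    then show ?thesis
      using card_consistent [OF assms True] by (simp add: coeff_eq [OF stack_in_RB])
  next
    case False
    then have "{l \<in> tuples n k. consistent (stacked_label i l j)} = {}"
      using consistent_imp_compatible_stack by blast
    with False show ?thesis
      by (simp only: card.empty) (simp add: coeff_eq [OF stack_in_RB])
  qed
  finally show ?thesis .
qed

end

section \<open>The representation\<close>

text \<open>The first index is the input tuple and the second the output tuple, as in
  \<open>coeff\<close>; a product therefore passes through the right factor before the left
  one.\<close>

definition matrix_coeff :: "nat \<Rightarrow> (diagram \<Rightarrow> complex) \<Rightarrow> (nat \<Rightarrow> nat) \<Rightarrow> (nat \<Rightarrow> nat) \<Rightarrow> complex" where
  "matrix_coeff k a i j = (\<Sum>d\<in>RB k. a d * coeff k d i j)"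

lemma action_apply:
  assumes "t \<in> tensor_power n k"
  shows "action n k d t m = (if m \<in> tuples n k then \<Sum>i\<in>tuples n k. t i * coeff k d i m else 0)"
proof -
  have "(\<Sum>j\<in>tuples n k. coeff k d i j * pure_tensor k (\<lambda>r. v (j r)) m) =
      (if m \<in> tuples n k then coeff k d i m else 0)" for i
  proof -
    have "(\<Sum>j\<in>tuples n k. coeff k d i j * pure_tensor k (\<lambda>r. v (j r)) m) =
        (\<Sum>j\<in>tuples n k. if m = j then coeff k d i j else 0)"
      by (rule sum.cong [OF refl], subst pure_tensor_basis, assumption, simp add: basis_vec_def)
    then show ?thesis
      by (simp add: finite_tuples)
  qed
  then show ?thesis
    using assms by (simp add: action_def)
qed

lemma \<pi>_apply:
  assumes "t \<in> tensor_power n k"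
  shows "\<pi> n k a t m =
    (if m \<in> tuples n k then \<Sum>i\<in>tuples n k. t i * matrix_coeff k a i m else 0)"
proof -
  have "(\<Sum>d\<in>RB k. a d * (\<Sum>i\<in>tuples n k. t i * coeff k d i m)) =
      (\<Sum>i\<in>tuples n k. t i * matrix_coeff k a i m)"
    unfolding matrix_coeff_def sum_distrib_left
    by (subst sum.swap) (simp add: mult_ac)
  then show ?thesis
    using assms by (simp add: \<pi>_def action_apply)
qed

lemma \<pi>_extensional: "\<pi> n k a \<in> extensional (tensor_power n k)"
  by (simp add: \<pi>_def)

lemma \<pi>_mem: "t \<in> tensor_power n k \<Longrightarrow> \<pi> n k a t \<in> tensor_power n k"
  using \<pi>_apply [of t n k a] by (simp add: tensor_power_def free_space_def)

lemma tensor_power_add: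
  "s \<in> tensor_power n k \<Longrightarrow> t \<in> tensor_power n k \<Longrightarrow> (\<lambda>i. s i + t i) \<in> tensor_power n k"
  by (simp add: tensor_power_def free_space_def)

lemma tensor_power_scale: "t \<in> tensor_power n k \<Longrightarrow> (\<lambda>i. c * t i) \<in> tensor_power n k"
  by (simp add: tensor_power_def free_space_def)

text \<open>By bilinearity this reduces to two diagrams, where \<open>sum_coeff\<close> trades the
  loop factor and the stacked diagram for a sum over middle rows.\<close>

lemma matrix_coeff_mult:
  assumes i: "i \<in> tuples n k" and m: "m \<in> tuples n k"
  shows "matrix_coeff k (mult (RB_algebra k (of_nat (n + 1))) a b) i m =
    (\<Sum>l\<in>tuples n k. matrix_coeff k a l m * matrix_coeff k b i l)"
proof -
  let ?x = "of_nat (n + 1) :: complex"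
  have "matrix_coeff k (mult (RB_algebra k ?x) a b) i m =
      (\<Sum>d\<in>RB k. \<Sum>d1\<in>RB k. \<Sum>d2\<in>RB k.
        a d1 * b d2 * ?x ^ loops k d1 d2 * (basis_vec (stack k d1 d2) d * coeff k d i m))"
    by (simp add: matrix_coeff_def RB_algebra_def sum_distrib_right sum_distrib_left mult_ac)
  \<comment> \<open>The sum over \<open>d\<close> moves inside so that it collapses on the single
    diagram \<open>stack k d1 d2\<close>.\<close>
  also have "\<dots> = (\<Sum>d1\<in>RB k. \<Sum>d2\<in>RB k. \<Sum>d\<in>RB k.
        a d1 * b d2 * ?x ^ loops k d1 d2 * (basis_vec (stack k d1 d2) d * coeff k d i m))"
    by (subst sum.swap, rule sum.cong [OF refl], rule sum.swap)
  also have "\<dots> = (\<Sum>d1\<in>RB k. \<Sum>d2\<in>RB k.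
        a d1 * b d2 * (\<Sum>l\<in>tuples n k. coeff k d1 l m * coeff k d2 i l))"
  proof (intro sum.cong refl)
    fix d1 d2 assume "d1 \<in> RB k" "d2 \<in> RB k"
    then interpret stacking k d1 d2
      by unfold_locales
    have "(\<Sum>d\<in>RB k. basis_vec (stack k d1 d2) d * coeff k d i m) = coeff k (stack k d1 d2) i m"
      by (rule sum_basis_vec [OF finite_RB stack_in_RB])
    then show "(\<Sum>d\<in>RB k. a d1 * b d2 * ?x ^ loops k d1 d2 *
          (basis_vec (stack k d1 d2) d * coeff k d i m)) =
        a d1 * b d2 * (\<Sum>l\<in>tuples n k. coeff k d1 l m * coeff k d2 i l)"
      by (simp only: sum_distrib_left [symmetric] sum_coeff [OF i m] mult.assoc)
  qed
  also have "\<dots> = (\<Sum>d1\<in>RB k. \<Sum>d2\<in>RB k. \<Sum>l\<in>tuples n k.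
        (a d1 * coeff k d1 l m) * (b d2 * coeff k d2 i l))"
    by (simp add: sum_distrib_left mult_ac)
  also have "\<dots> = (\<Sum>d1\<in>RB k. \<Sum>l\<in>tuples n k. \<Sum>d2\<in>RB k.
        (a d1 * coeff k d1 l m) * (b d2 * coeff k d2 i l))"
    by (rule sum.cong [OF refl], rule sum.swap)
  also have "\<dots> = (\<Sum>l\<in>tuples n k. \<Sum>d1\<in>RB k. \<Sum>d2\<in>RB k.
        (a d1 * coeff k d1 l m) * (b d2 * coeff k d2 i l))"
    by (rule sum.swap)
  also have "\<dots> = (\<Sum>l\<in>tuples n k. matrix_coeff k a l m * matrix_coeff k b i l)"
    by (simp add: matrix_coeff_def sum_product)
  finally show ?thesis .
qed

lemma id_diagram_in_RB: "id_diagram k \<in> RB k"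
  by (auto simp: RB_def id_diagram_def vertices_def doubleton_eq_iff)

text \<open>There are no isolated vertices, and the vertical edges force agreement at each position.
  Tuples are extensional, so this is equality.\<close>

lemma coeff_id_diagram:
  assumes "i \<in> tuples n k" "j \<in> tuples n k"
  shows "coeff k (id_diagram k) i j = of_bool (i = j)"
proof -
  have "isolated k (id_diagram k) = {}"
    by (auto simp: isolated_def id_diagram_def vertices_def)
  then have "compatible k (id_diagram k) (label i j) \<longleftrightarrow> (\<forall>r\<in>{1..k}. i r = j r)"
    by (auto simp: compatible_def id_diagram_def)
  also have "\<dots> \<longleftrightarrow> i = j"
    using assms extensionalityI [of i "{1..k}" j] by (auto simp: tuples_def PiE_def)
  finally show ?thesis
    by (simp add: coeff_eq [OF id_diagram_in_RB])
qed

section \<open>Linearity and the homomorphism laws\<close>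

lemma \<pi>_in_carrier: "\<pi> n k a \<in> carrier (End_algebra n k)"
proof -
  have "\<pi> n k a \<in> tensor_power n k \<rightarrow>\<^sub>E tensor_power n k"
    using \<pi>_mem \<pi>_extensional by (auto simp: PiE_def)
  moreover have "\<pi> n k a (\<lambda>i. s i + t i) = (\<lambda>i. \<pi> n k a s i + \<pi> n k a t i)"
    if "s \<in> tensor_power n k" "t \<in> tensor_power n k" for s t
    using that by (intro ext) (simp add: \<pi>_apply tensor_power_add sum.distrib distrib_right)
  moreover have "\<pi> n k a (\<lambda>i. c * t i) = (\<lambda>i. c * \<pi> n k a t i)"
    if "t \<in> tensor_power n k" for c t
    using that by (intro ext) (simp add: \<pi>_apply tensor_power_scale sum_distrib_left mult.assoc)
  ultimately show ?thesis
    by (simp add: End_algebra_def Let_def)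
qed

lemma \<pi>_mult:
  "\<pi> n k (mult (RB_algebra k (of_nat (n + 1))) a b) =
     compose (tensor_power n k) (\<pi> n k a) (\<pi> n k b)"
proof (rule extensionalityI [OF \<pi>_extensional compose_extensional])
  fix t assume t: "t \<in> tensor_power n k"
  show "\<pi> n k (mult (RB_algebra k (of_nat (n + 1))) a b) t =
      compose (tensor_power n k) (\<pi> n k a) (\<pi> n k b) t"
  proof
    fix m
    show "\<pi> n k (mult (RB_algebra k (of_nat (n + 1))) a b) t m =
        compose (tensor_power n k) (\<pi> n k a) (\<pi> n k b) t m"
    proof (cases "m \<in> tuples n k")
      case True
      then have "\<pi> n k (mult (RB_algebra k (of_nat (n + 1))) a b) t m =
          (\<Sum>i\<in>tuples n k. \<Sum>l\<in>tuples n k. t i * (matrix_coeff k a l m * matrix_coeff k b i l))"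
        using t by (simp only: \<pi>_apply matrix_coeff_mult sum_distrib_left if_True cong: sum.cong)
      \<comment> \<open>With the middle tuple \<open>l\<close> outermost, the inner sum over
        \<open>i\<close> is the coordinate of \<open>\<pi> n k b t\<close> at
        \<open>l\<close>.\<close>
      also have "\<dots> = (\<Sum>l\<in>tuples n k. \<Sum>i\<in>tuples n k.
          t i * (matrix_coeff k a l m * matrix_coeff k b i l))"
        by (rule sum.swap)
      also have "\<dots> = (\<Sum>l\<in>tuples n k. \<pi> n k b t l * matrix_coeff k a l m)"
        using t by (simp add: \<pi>_apply sum_distrib_left mult_ac)
      also have "\<dots> = compose (tensor_power n k) (\<pi> n k a) (\<pi> n k b) t m"
        using True t \<pi>_apply [OF \<pi>_mem [OF t]] by (simp add: compose_def)
      finally show ?thesis .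
    next
      case False
      then show ?thesis
        using t \<pi>_mem by (simp add: compose_def \<pi>_apply)
    qed
  qed
qed

lemma \<pi>_one: "\<pi> n k (basis_vec (id_diagram k)) = (\<lambda>t\<in>tensor_power n k. t)"
proof (rule extensionalityI [OF \<pi>_extensional restrict_extensional])
  fix t assume t: "t \<in> tensor_power n k"
  have "\<pi> n k (basis_vec (id_diagram k)) t m = t m" for m
  proof (cases "m \<in> tuples n k")
    case True
    have "(\<Sum>i\<in>tuples n k. t i * coeff k (id_diagram k) i m) =
        (\<Sum>i\<in>tuples n k. if m = i then t i else 0)"
      using True by (intro sum.cong) (auto simp: coeff_id_diagram)
    with True t show ?thesis
      by (simp add: \<pi>_basis [OF id_diagram_in_RB] action_apply finite_tuples)
  next
    case False
    with t show ?thesis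
      by (simp add: \<pi>_apply) (simp add: tensor_power_def free_space_def)
  qed
  then show "\<pi> n k (basis_vec (id_diagram k)) t = (\<lambda>t\<in>tensor_power n k. t) t"
    using t by auto
qed

lemma \<pi>_add: "\<pi> n k (\<lambda>d. a d + b d) = (\<lambda>t\<in>tensor_power n k. \<lambda>i. \<pi> n k a t i + \<pi> n k b t i)"
  by (intro extensionalityI [OF \<pi>_extensional restrict_extensional] ext)
    (simp add: \<pi>_def sum.distrib distrib_right)

lemma \<pi>_scale: "\<pi> n k (\<lambda>d. c * a d) = (\<lambda>t\<in>tensor_power n k. \<lambda>i. c * \<pi> n k a t i)"
  by (intro extensionalityI [OF \<pi>_extensional restrict_extensional] ext)
    (simp add: \<pi>_def sum_distrib_left mult.assoc)

theorem proposition3p14: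
  fixes k n :: nat
  assumes "n \<ge> 1"
  shows "\<pi> n k \<in> algebra_hom (RB_algebra k (of_nat (n + 1))) (End_algebra n k)"
proof -
  let ?A = "RB_algebra k (of_nat (n + 1))" and ?B = "End_algebra n k"
  have "\<pi> n k \<in> ring_hom ?A ?B"
  proof (rule ring_hom_memI)
    show "\<pi> n k a \<in> carrier ?B" for a
      by (rule \<pi>_in_carrier)
    show "\<pi> n k (a \<otimes>\<^bsub>?A\<^esub> b) = \<pi> n k a \<otimes>\<^bsub>?B\<^esub> \<pi> n k b" for a b
      unfolding \<pi>_mult by (simp add: End_algebra_def Let_def)
    show "\<pi> n k (a \<oplus>\<^bsub>?A\<^esub> b) = \<pi> n k a \<oplus>\<^bsub>?B\<^esub> \<pi> n k b" for a b
      using \<pi>_add [of n k a b] by (simp add: RB_algebra_def End_algebra_def Let_def)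
    show "\<pi> n k \<one>\<^bsub>?A\<^esub> = \<one>\<^bsub>?B\<^esub>"
      using \<pi>_one [of n k] by (simp add: RB_algebra_def End_algebra_def Let_def)
  qed
  moreover have "\<pi> n k (c \<odot>\<^bsub>?A\<^esub> a) = c \<odot>\<^bsub>?B\<^esub> \<pi> n k a" for c a
    using \<pi>_scale [of n k c a] by (simp add: RB_algebra_def End_algebra_def Let_def)
  ultimately show ?thesis
    by (simp add: algebra_hom_def)
qed

end
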